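(* Let $\delta=\tfrac12$ and $U_\delta=\{y\in\mathbb{R}^2:\delta<\|y\|<1\}$. There exist constants $0<\eta<\delta$ and $\epsilon_0>0$ such that, for every $0<\epsilon\leq\epsilon_0$ and every $0<\sigma<\eta$, the central maximal function $M_cf_a$ of \[ f_a(y)=\chi_{U_\delta}(y)+\epsilon\,\chi_{B(a,\sigma)}(y),\qquad y\in\mathbb{R}^2, \] is independent of $a$ whenever $a\in\mathbb{R}^2$ satisfies $\|a\|+\sigma<\eta$ (that is, $M_cf_a(x)=M_cf_{a'}(x)$ for every $x\in\mathbb{R}^2$ and all $a,a'\in\mathbb{R}^2$ with $\|a\|+\sigma<\eta$ and $\|a'\|+\sigma<\eta$). In particular, for every $0<\epsilon\le\epsilon_0$, if \[ \sigma=\frac{\eta}{8},\qquad a=\left(\frac{\eta}{4},0\right),\qquad b=\left(-\frac{\eta}{4},0\right), \] then $f=f_a$ and $g=f_b$ are bounded, nonnegative, compactly supported functions in $L^1(\mathbb{R}^2)$ satisfying \[ M_cf(x)=M_cg(x)\quad\text{for every }x\in\mathbb{R}^2,\qquad \|f-g\|_1=2\epsilon\pi\sigma^2>0. \]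
   Context: $B(x,r)=\{y\in\mathbb{R}^2:\|x-y\|<r\}$ is the open Euclidean disk and $|E|$ is Lebesgue measure. For $f\in L^1_{\mathrm{loc}}(\mathbb{R}^2)$, the central Hardy--Littlewood maximal function is $M_cf(x)=\sup_{r>0}\frac{1}{|B(x,r)|}\int_{B(x,r)}|f(t)|\,dt$. $\chi_A$ denotes the characteristic function of $A$. *)

theory Defs
  imports "HOL-Analysis.Analysis"
begin

text \<open>
  The maximal function takes values in the extended nonnegative reals, so that the supremum is
  meaningful for every locally integrable function, including where it is infinite.
\<close>

definition central_maximal :: "(real^2 \<Rightarrow> real) \<Rightarrow> real^2 \<Rightarrow> ennreal" where
  "central_maximal f x =
     (SUP r\<in>{0<..}. (\<integral>\<^sup>+t\<in>ball x r. ennreal \<bar>f t\<bar> \<partial>lebesgue) / emeasure lebesgue (ball x r))"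

definition annulus :: "real \<Rightarrow> (real^2) set" where
  "annulus \<delta> = {y. \<delta> < norm y \<and> norm y < 1}"

definition annulus_bump :: "real \<Rightarrow> real \<Rightarrow> real \<Rightarrow> real^2 \<Rightarrow> real^2 \<Rightarrow> real" where
  "annulus_bump \<delta> \<epsilon> \<sigma> a y = indicator (annulus \<delta>) y + \<epsilon> * indicator (ball a \<sigma>) y"

definition compactly_supported :: "(real^2 \<Rightarrow> real) \<Rightarrow> bool" where
  "compactly_supported f \<longleftrightarrow> compact (closure {y. f y \<noteq> 0})"

definition L1_norm :: "(real^2 \<Rightarrow> real) \<Rightarrow> ennreal" where
  "L1_norm f = (\<integral>\<^sup>+y. ennreal \<bar>f y\<bar> \<partial>lebesgue)"

end

theory Submission
  imports Defs
begin

text \<open>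
  Fix a centre \<open>x\<close>. As long as the bump lies in the disc of radius \<open>\<eta>\<close> about the origin, the average of the
  function over \<open>ball x r\<close> can depend on the position of the bump only if the circle of radius \<open>r\<close>
  about \<open>x\<close> enters that disc, that is, if \<open>r\<close> differs from \<open>norm x\<close> by less than \<open>\<eta>\<close>. The
  maximal function is therefore independent of the position of the bump as soon as these critical radii
  are irrelevant for the supremum: each of their averages, bump included, must be at most the average
  of the bare annulus at some other radius (\<open>critical_radius_beaten\<close>).

  For a small bump and a small \<open>\<eta>\<close> this follows, by compactness in the centre
  (\<open>uniform_gain_middle\<close>), from its limiting form: for the indicator of the annulus, the radius
  \<open>r = norm x\<close>, whose circle passes through the origin, never gives the largest average
  (\<open>through_origin_not_optimal\<close>). The reason depends on \<open>s = norm x\<close>.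

  \<^item> For \<open>s < 1/2\<close> the hole is convex and contains \<open>x\<close>, so its share of the disc decreases as the disc
  grows inside the unit disc.
  \<^item> For \<open>s = 1/2\<close> the disc already touches the unit circle, but growing it a little still helps: the
  arc that leaves the unit disc is so short that the area lost is of higher order than the area gained.
  \<^item> For \<open>1/2 < s < 1\<close> small discs have average \<open>1\<close>.
  \<^item> For \<open>s\<close> from \<open>1\<close> to almost \<open>2\<close> the average is strictly decreasing at \<open>r = s\<close>.
  \<^item> For larger \<open>s\<close> the disc through the origin meets less than half of the annulus, and the disc covering
  all of it, of radius \<open>s + 1\<close>, does better.

  The borderline between the last two cases leaves so little room that crude estimates of the areas do not
  suffice. Sharp ones come from the polar formula \<open>overlap_eq_integral\<close>, which turns the area of the
  annulus inside a disc into an integral of \<open>arccos\<close>.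
\<close>

section \<open>Area in polar coordinates\<close>

lemma Basis_real_2: "(Basis :: (real^2) set) = {axis 1 1, axis 2 1}"
  by (auto simp: Basis_vec_def UNIV_2)

lemma continuous_on_vector_2 [continuous_intros]:
  fixes f g :: "'a::topological_space \<Rightarrow> real"
  assumes "continuous_on S f" "continuous_on S g"
  shows "continuous_on S (\<lambda>x. vector [f x, g x] :: real^2)"
proof -
  have "continuous_on S (\<lambda>x. (\<chi> i. if i = 1 then f x else g x) :: real^2)"
  proof (intro continuous_on_vec_lambda)
    fix i :: 2
    show "continuous_on S (\<lambda>x. if i = 1 then f x else g x)"
      using assms by (cases "i = 1") auto
  qed
  moreover have "(\<lambda>x. vector [f x, g x] :: real^2) = (\<lambda>x. (\<chi> i. if i = 1 then f x else g x) :: real^2)"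
    by (auto simp: vec_eq_iff forall_2)
  ultimately show ?thesis by (simp only:)
qed

lemma lborel_real_2_eq_distr:
  "(lborel :: (real^2) measure) = distr lborel borel (\<lambda>p. vector [fst p, snd p])"
proof (rule lborel_eqI)
  have meas: "(\<lambda>p::real\<times>real. vector [fst p, snd p] :: real^2) \<in> borel_measurable lborel"
    unfolding measurable_lborel2
    by (intro borel_measurable_continuous_onI continuous_intros)
  fix l u :: "real^2"
  assume le: "\<And>b. b \<in> Basis \<Longrightarrow> l \<bullet> b \<le> u \<bullet> b"
  have le': "l $ 1 \<le> u $ 1" "l $ 2 \<le> u $ 2"
    using le[of "axis 1 1"] le[of "axis 2 1"] by (auto simp: Basis_real_2 inner_axis)
  have pre: "(\<lambda>p. vector [fst p, snd p]) -` box l u = box (l $ 1, l $ 2) (u $ 1, u $ 2)"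
    by (auto simp: mem_box_cart forall_2 mem_box(1) Basis_prod_def)
  have "emeasure (distr lborel borel (\<lambda>p. vector [fst p, snd p])) (box l u)
      = emeasure lborel (box (l $ 1, l $ 2) (u $ 1, u $ 2))"
    using meas by (subst emeasure_distr) (auto simp: pre)
  also have "\<dots> = ennreal ((u $ 1 - l $ 1) * (u $ 2 - l $ 2))"
    using le' by (subst emeasure_lborel_box_eq) (auto simp: Basis_prod_def prod.union_disjoint)
  also have "\<dots> = ennreal (\<Prod>b\<in>Basis. (u - l) \<bullet> b)"
    by (simp add: Basis_real_2 inner_axis axis_eq_axis)
  finally show "emeasure (distr lborel borel (\<lambda>p. vector [fst p, snd p])) (box l u) = \<dots>" .
qed auto

text \<open>Fubini's theorem for \<open>real^2\<close>: coordinates identify Lebesgue measure on \<open>real^2\<close> with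
  the product measure, because both give every box the product of its side lengths.\<close>

lemma nn_integral_real_2:
  fixes f :: "real^2 \<Rightarrow> ennreal"
  assumes [measurable]: "f \<in> borel_measurable borel"
  shows "(\<integral>\<^sup>+p. f p \<partial>lborel) = (\<integral>\<^sup>+x. \<integral>\<^sup>+y. f (vector [x, y]) \<partial>lborel \<partial>lborel)"
proof -
  have [measurable]: "(\<lambda>p::real\<times>real. vector [fst p, snd p] :: real^2) \<in> borel_measurable borel"
    by (intro borel_measurable_continuous_onI continuous_intros)
  have "(\<integral>\<^sup>+p. f p \<partial>lborel) = (\<integral>\<^sup>+p. f (vector [fst p, snd p]) \<partial>lborel)"
    by (subst lborel_real_2_eq_distr, subst nn_integral_distr) auto
  also have "\<dots> = (\<integral>\<^sup>+p. f (vector [fst p, snd p]) \<partial>(lborel \<Otimes>\<^sub>M lborel))"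
    by (simp add: lborel_prod)
  also have "\<dots> = (\<integral>\<^sup>+x. \<integral>\<^sup>+y. f (vector [x, y]) \<partial>lborel \<partial>lborel)"
    by (subst lborel.nn_integral_fst[symmetric]) (auto simp: lborel_prod)
  finally show ?thesis .
qed

abbreviation polar :: "real^2 \<Rightarrow> real^2" where
  "polar p \<equiv> vector [p $ 1 * cos (p $ 2), p $ 1 * sin (p $ 2)]"

lemma has_derivative_polar:
  "(polar has_derivative
     (\<lambda>h. vector [h $ 1 * cos (p $ 2) - p $ 1 * sin (p $ 2) * h $ 2,
                  h $ 1 * sin (p $ 2) + p $ 1 * cos (p $ 2) * h $ 2])) (at p within S)"
proof -
  have c: "((\<lambda>q::real^2. q $ i) has_derivative (\<lambda>h. h $ i)) (at p within S)" for i
    by (rule bounded_linear_imp_has_derivative) (rule bounded_linear_vec_nth)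
  show ?thesis
    unfolding has_derivative_componentwise_within[of polar]
    by (auto simp: Basis_real_2 inner_axis algebra_simps intro!: derivative_eq_intros c)
qed

lemma det_polar:
  "det (matrix (\<lambda>h::real^2. vector [h $ 1 * cos t - r * sin t * h $ 2,
                  h $ 1 * sin t + r * cos t * h $ 2] :: real^2)) = r"
proof -
  have "r * (cos t)\<^sup>2 + r * (sin t)\<^sup>2 = r"
    by (simp flip: distrib_left)
  then show ?thesis
    by (simp add: det_2 matrix_def axis_def power2_eq_square algebra_simps)
qed

lemma inj_on_polar: "inj_on polar {p. 0 < p $ 1 \<and> - pi < p $ 2 \<and> p $ 2 < pi}"
proof (rule inj_onI)
  fix p q :: "real^2"
  assume p: "p \<in> {p. 0 < p $ 1 \<and> - pi < p $ 2 \<and> p $ 2 < pi}"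
    and q: "q \<in> {p. 0 < p $ 1 \<and> - pi < p $ 2 \<and> p $ 2 < pi}"
    and "polar p = polar q"
  then have eq: "p $ 1 * cos (p $ 2) = q $ 1 * cos (q $ 2)" "p $ 1 * sin (p $ 2) = q $ 1 * sin (q $ 2)"
    by (auto simp: vec_eq_iff forall_2)
  have "(p $ 1)\<^sup>2 = (p $ 1 * cos (p $ 2))\<^sup>2 + (p $ 1 * sin (p $ 2))\<^sup>2"
    by (simp add: power_mult_distrib flip: distrib_left)
  also have "\<dots> = (q $ 1)\<^sup>2"
    unfolding eq by (simp add: power_mult_distrib flip: distrib_left)
  finally have 1: "p $ 1 = q $ 1"
    using p q by (simp add: power2_eq_iff_nonneg)
  have "p $ 2 = q $ 2"
  proof -
    have "sin (p $ 2) = sin (q $ 2) \<and> cos (p $ 2) = cos (q $ 2)"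
      using p q eq 1 by auto
    then obtain n :: int where n: "p $ 2 = q $ 2 + 2 * pi * n"
      using sin_cos_eq_iff[of "p $ 2" "q $ 2"] by auto
    then have "2 * pi * n = p $ 2 - q $ 2"
      by simp
    then have "\<bar>2 * pi * n\<bar> < 2 * pi * 1"
      unfolding abs_less_iff using p q by auto
    then have "\<bar>real_of_int n\<bar> < 1"
      by (simp add: abs_mult)
    then have "n = 0"
      by linarith
    with n show ?thesis by simp
  qed
  with 1 show "p = q"
    by (simp add: vec_eq_iff forall_2)
qed

text \<open>Area in polar coordinates: the Jacobian of \<open>polar\<close> is the radius, and the circle of radius
  \<open>\<tau>\<close> meets the region in an arc of angle \<open>2 * \<alpha> \<tau>\<close>.\<close>

lemma has_measure_polar_image:
  fixes \<alpha> :: "real \<Rightarrow> real"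
  assumes "0 \<le> a" and cont: "continuous_on {a..b} \<alpha>"
    and \<alpha>: "\<And>\<tau>. \<tau> \<in> {a..b} \<Longrightarrow> 0 \<le> \<alpha> \<tau> \<and> \<alpha> \<tau> \<le> pi"
  defines "P \<equiv> {p :: real^2. a < p $ 1 \<and> p $ 1 < b \<and> \<bar>p $ 2\<bar> < \<alpha> (p $ 1)}"
  shows "polar ` P \<in> lmeasurable"
    and "measure lebesgue (polar ` P) = integral {a..b} (\<lambda>\<tau>. 2 * \<tau> * \<alpha> \<tau>)"
proof -
  define I where "I = integral {a..b} (\<lambda>\<tau>. 2 * \<tau> * \<alpha> \<tau>)"
  have int: "((\<lambda>\<tau>. 2 * \<tau> * \<alpha> \<tau>) has_integral I) {a..b}"
    unfolding I_def
    by (intro integrable_integral integrable_continuous_interval continuous_intros cont)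
  have I_nonneg: "0 \<le> I"
    using \<alpha> \<open>0 \<le> a\<close> by (intro has_integral_nonneg[OF int]) auto
  have "open ({p :: real^2. a < p $ 1 \<and> p $ 1 < b} \<inter> (\<lambda>p. \<alpha> (p $ 1) - \<bar>p $ 2\<bar>) -` {0<..})"
  proof (rule continuous_open_preimage)
    show "open {p :: real^2. a < p $ 1 \<and> p $ 1 < b}"
      by (intro open_Collect_conj open_Collect_less continuous_intros)
    show "continuous_on {p :: real^2. a < p $ 1 \<and> p $ 1 < b} (\<lambda>p. \<alpha> (p $ 1) - \<bar>p $ 2\<bar>)"
      by (intro continuous_intros continuous_on_compose2[OF cont]) auto
  qed auto
  moreover have "{p :: real^2. a < p $ 1 \<and> p $ 1 < b} \<inter> (\<lambda>p. \<alpha> (p $ 1) - \<bar>p $ 2\<bar>) -` {0<..} = P"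
    by (auto simp: P_def)
  ultimately have "open P" by simp
  then have P_borel [measurable]: "P \<in> sets borel" by auto
  have inner: "(\<integral>\<^sup>+y. ennreal \<bar>x\<bar> * indicator P (vector [x, y]) \<partial>lborel)
      = ennreal (2 * x * \<alpha> x) * indicator {a<..<b} x" for x
  proof (cases "x \<in> {a<..<b}")
    case True
    then have "(\<lambda>y. ennreal \<bar>x\<bar> * indicator P (vector [x, y])) =
        (\<lambda>y. ennreal \<bar>x\<bar> * indicator {- \<alpha> x<..<\<alpha> x} y)"
      by (auto simp: P_def indicator_def fun_eq_iff)
    then have "(\<integral>\<^sup>+y. ennreal \<bar>x\<bar> * indicator P (vector [x, y]) \<partial>lborel)
        = ennreal \<bar>x\<bar> * emeasure lborel {- \<alpha> x<..<\<alpha> x}"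
      by (simp add: nn_integral_cmult_indicator)
    also have "\<dots> = ennreal (2 * x * \<alpha> x)"
      using True \<alpha>[of x] \<open>0 \<le> a\<close> by (simp flip: ennreal_mult add: mult_ac)
    finally show ?thesis using True by simp
  next
    case False
    then have "(\<lambda>y. ennreal \<bar>x\<bar> * indicator P (vector [x, y])) = (\<lambda>y. 0)"
      by (auto simp: P_def indicator_def fun_eq_iff)
    then show ?thesis using False by simp
  qed
  have [measurable]: "(\<lambda>p::real^2. p $ 1) \<in> borel_measurable borel"
    by (intro borel_measurable_continuous_onI continuous_intros)
  have "(\<integral>\<^sup>+p. ennreal (\<bar>p $ 1\<bar> * indicator P p) \<partial>lborel)
      = (\<integral>\<^sup>+p. ennreal \<bar>p $ 1\<bar> * indicator P p \<partial>lborel)"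
    by (intro nn_integral_cong) (auto simp: indicator_def)
  also have "\<dots> = (\<integral>\<^sup>+x. \<integral>\<^sup>+y. ennreal \<bar>x\<bar> * indicator P (vector [x, y]) \<partial>lborel \<partial>lborel)"
    by (subst nn_integral_real_2) simp_all
  also have "\<dots> = (\<integral>\<^sup>+x. ennreal (2 * x * \<alpha> x) * indicator {a<..<b} x \<partial>lborel)"
    by (simp only: inner)
  also have "\<dots> = ennreal I"
    using \<alpha> \<open>0 \<le> a\<close> int by (intro nn_integral_has_integral_lebesgue') (auto simp: has_integral_Icc_iff_Ioo)
  finally have "((\<lambda>p. \<bar>p $ 1\<bar> * indicator P p) has_integral I) UNIV"
    using I_nonneg by (intro nn_integral_has_integral) auto
  then have "((\<lambda>p. if p \<in> P then \<bar>p $ 1\<bar> else 0) has_integral I) UNIV"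
    by (rule has_integral_eq[rotated]) (auto simp: indicator_def)
  then have "((\<lambda>p. \<bar>p $ 1\<bar>) has_integral I) P"
    by (simp only: has_integral_restrict_UNIV)
  then have "polar ` P \<in> lmeasurable \<and> measure lebesgue (polar ` P) = I"
  proof (subst has_measure_differentiable_image[OF _ has_derivative_polar])
    show "inj_on polar P"
    proof (rule inj_on_subset[OF inj_on_polar], rule subsetI)
      fix p assume "p \<in> P"
      then show "p \<in> {p. 0 < p $ 1 \<and> - pi < p $ 2 \<and> p $ 2 < pi}"
        using \<alpha>[of "p $ 1"] \<open>0 \<le> a\<close> by (auto simp: P_def)
    qed
  qed (use P_borel in \<open>auto simp: det_polar\<close>)
  then show "polar ` P \<in> lmeasurable" "measure lebesgue (polar ` P) = I"
    by auto
qed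

section \<open>The area of the annulus inside a disc\<close>

text \<open>Divided by \<open>pi * r\<^sup>2\<close>, this is the average over the disc of the indicator of the annulus,
  that is, of the function without its bump.\<close>

definition overlap :: "real^2 \<Rightarrow> real \<Rightarrow> real" where
  "overlap x r = measure lebesgue (ball x r \<inter> annulus (1/2))"

abbreviation e1 :: "real^2" where "e1 \<equiv> axis 1 1"

lemma norm_real_2: "(norm (p :: real^2))\<^sup>2 = (p $ 1)\<^sup>2 + (p $ 2)\<^sup>2"
  by (simp add: norm_vec_def L2_set_def UNIV_2)

lemma dist_e1_sq:
  "(dist (s *\<^sub>R e1) (p :: real^2))\<^sup>2 = s\<^sup>2 + (norm p)\<^sup>2 - 2 * s * p $ 1"
  unfolding dist_norm norm_real_2 by (simp add: power2_eq_square algebra_simps axis_def)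

text \<open>A point of norm \<open>\<tau>\<close> at polar angle \<open>\<phi>\<close> has squared distance
  \<open>s\<^sup>2 + \<tau>\<^sup>2 - 2 * s * \<tau> * cos \<phi>\<close> from \<open>s *\<^sub>R e1\<close>, so the disc cuts from the circle of radius
  \<open>\<tau>\<close> the arc on which \<open>cos \<phi>\<close> exceeds \<open>(\<tau>\<^sup>2 + (s\<^sup>2 - r\<^sup>2)) / (2 * s * \<tau>)\<close>. The hypothesis says
  that every circle about the origin that lies in the annulus really meets the circle bounding the disc.\<close>

lemma overlap_eq_integral:
  fixes s r :: real
  assumes s: "0 < s" and r: "0 < r"
    and meets: "\<And>\<tau>. \<tau> \<in> {1/2..1} \<Longrightarrow> \<bar>\<tau>\<^sup>2 + (s\<^sup>2 - r\<^sup>2)\<bar> \<le> 2 * s * \<tau>"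
  shows "overlap (s *\<^sub>R e1) r =
    integral {1/2..1} (\<lambda>\<tau>. 2 * \<tau> * arccos ((\<tau>\<^sup>2 + (s\<^sup>2 - r\<^sup>2)) / (2 * s * \<tau>)))"
proof -
  define c where "c \<tau> = (\<tau>\<^sup>2 + (s\<^sup>2 - r\<^sup>2)) / (2 * s * \<tau>)" for \<tau>
  have c: "- 1 \<le> c \<tau> \<and> c \<tau> \<le> 1" if "\<tau> \<in> {1/2..1}" for \<tau>
    using meets[OF that] that s unfolding c_def by (auto simp: field_simps abs_le_iff)
  have arccos_c: "0 \<le> arccos (c \<tau>) \<and> arccos (c \<tau>) \<le> pi" if "\<tau> \<in> {1/2..1}" for \<tau>
    using c[OF that] by (simp add: arccos_lbound arccos_ubound)
  have cont: "continuous_on {1/2..1} (\<lambda>\<tau>. arccos (c \<tau>))"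
    using s c unfolding c_def by (intro continuous_intros) auto
  define P where "P = {p :: real^2. 1/2 < p $ 1 \<and> p $ 1 < 1 \<and> \<bar>p $ 2\<bar> < arccos (c (p $ 1))}"
  have in_ball: "p \<in> ball (s *\<^sub>R e1) r \<longleftrightarrow> c (norm p) < p $ 1 / norm p"
    if "norm p \<in> {1/2..1}" for p :: "real^2"
  proof -
    have "p \<in> ball (s *\<^sub>R e1) r \<longleftrightarrow> (dist (s *\<^sub>R e1) p)\<^sup>2 < r\<^sup>2"
      using r power2_less_imp_less[of "dist (s *\<^sub>R e1) p" r]
        power_strict_mono[of "dist (s *\<^sub>R e1) p" r 2] by auto
    also have "\<dots> \<longleftrightarrow> (norm p)\<^sup>2 + (s\<^sup>2 - r\<^sup>2) < 2 * s * p $ 1"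
      unfolding dist_e1_sq by auto
    also have "\<dots> \<longleftrightarrow> c (norm p) < (2 * s * p $ 1) / (2 * s * norm p)"
    proof -
      have "0 < 2 * s * norm p" using that s by (intro mult_pos_pos) auto
      then show ?thesis unfolding c_def divide_less_cancel by linarith
    qed
    also have "(2 * s * p $ 1) / (2 * s * norm p) = p $ 1 / norm p"
      using s by simp
    finally show ?thesis .
  qed
  have "polar ` P = ball (s *\<^sub>R e1) r \<inter> annulus (1/2)"
  proof (intro equalityI subsetI)
    fix y assume "y \<in> polar ` P"
    then obtain p where p: "p \<in> P" and y: "y = polar p" by auto
    have "(norm y)\<^sup>2 = (p $ 1)\<^sup>2"
      by (simp add: y norm_real_2 power_mult_distrib flip: distrib_left)
    then have n: "norm y = p $ 1"
      using p by (simp add: P_def)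
    have p1: "p $ 1 \<in> {1/2..1}" using p by (auto simp: P_def)
    have "cos (arccos (c (p $ 1))) < cos \<bar>p $ 2\<bar>"
      using p arccos_c[OF p1] by (intro cos_monotone_0_pi) (auto simp: P_def)
    moreover have "y $ 1 = p $ 1 * cos (p $ 2)"
      by (simp add: y)
    ultimately have "c (norm y) < y $ 1 / norm y"
      using c[OF p1] p1 by (simp add: n)
    then show "y \<in> ball (s *\<^sub>R e1) r \<inter> annulus (1/2)"
      using in_ball[of y] p by (auto simp: n P_def annulus_def)
  next
    fix y assume y: "y \<in> ball (s *\<^sub>R e1) r \<inter> annulus (1/2)"
    then have n: "1/2 < norm y" "norm y < 1" by (auto simp: annulus_def)
    have "(y $ 1 / norm y)\<^sup>2 + (y $ 2 / norm y)\<^sup>2 = (norm y)\<^sup>2 / (norm y)\<^sup>2"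
      by (simp only: power_divide add_divide_distrib[symmetric] norm_real_2[of y])
    then have "(y $ 1 / norm y)\<^sup>2 + (y $ 2 / norm y)\<^sup>2 = 1"
      using n by (simp split: if_splits)
    then obtain t where t: "0 \<le> t" "t < 2 * pi" "y $ 1 / norm y = cos t" "y $ 2 / norm y = sin t"
      by (rule sincos_total_2pi)
    \<comment> \<open>the representative of the angle in the interval of half-length \<open>pi\<close> about zero\<close>
    define u where "u = (if t \<le> pi then t else t - 2 * pi)"
    have u: "\<bar>u\<bar> \<le> pi" "y $ 1 / norm y = cos u" "y $ 2 / norm y = sin u"
      using t by (auto simp: u_def cos_diff sin_diff)
    have "c (norm y) < cos \<bar>u\<bar>"
      using in_ball[of y] y n u by auto
    then have "\<bar>u\<bar> < arccos (c (norm y))"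
      using u c[of "norm y"] n arccos_less_mono[of "cos \<bar>u\<bar>" "c (norm y)"]
        arccos_cos[of "\<bar>u\<bar>"] by (auto simp: abs_le_iff)
    moreover have "y = polar (vector [norm y, u])"
      using u n by (auto simp: vec_eq_iff forall_2 field_simps simp flip: u(2,3))
    ultimately show "y \<in> polar ` P"
      using n by (intro image_eqI[of _ _ "vector [norm y, u]"]) (auto simp: P_def)
  qed
  then show ?thesis
    using has_measure_polar_image(2)[OF _ cont arccos_c]
    by (simp add: overlap_def P_def c_def)
qed

lemma open_annulus: "open (annulus \<delta>)"
  unfolding annulus_def by (intro open_Collect_conj open_Collect_less continuous_intros)

lemma lmeasurable_ball_annulus: "ball x r \<inter> annulus \<delta> \<in> lmeasurable"
  by (intro lmeasurable_open open_Int open_annulus open_ball bounded_Int) auto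

lemma measure_disc: "0 \<le> r \<Longrightarrow> measure lborel (ball (x :: real^2) r) = pi * r\<^sup>2"
  using content_ball[of r x] unit_ball_vol_2 by simp

lemma measure_cdisc: "0 \<le> r \<Longrightarrow> measure lborel (cball (x :: real^2) r) = pi * r\<^sup>2"
  using content_cball[of r x] unit_ball_vol_2 by simp

lemma overlap_nonneg: "0 \<le> overlap x r"
  by (simp add: overlap_def)

text \<open>The annulus is invariant under rotations.\<close>

lemma overlap_norm_cong:
  assumes "norm x = norm y"
  shows "overlap x r = overlap y r"
proof -
  obtain f where f: "orthogonal_transformation f" "f x = y"
    using orthogonal_transformation_exists[OF assms] .
  have "f ` (ball x r \<inter> annulus (1/2)) = f ` ball x r \<inter> f ` annulus (1/2)"
    using orthogonal_transformation_inj[OF f(1)] by (rule image_Int)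
  moreover have "f ` ball x r = ball y r"
    using image_orthogonal_transformation_ball[OF f(1)] f(2) by simp
  moreover have "f ` annulus (1/2) = annulus (1/2)"
  proof (intro equalityI subsetI)
    fix z assume "z \<in> annulus (1/2)"
    moreover obtain w where w: "z = f w"
      using orthogonal_transformation_surj[OF f(1)] by (metis surjD)
    ultimately show "z \<in> f ` annulus (1/2)"
      using f(1) by (auto simp: annulus_def orthogonal_transformation_norm)
  qed (use f(1) in \<open>auto simp: annulus_def orthogonal_transformation_norm\<close>)
  ultimately show ?thesis
    using measure_orthogonal_image[OF f(1) lmeasurable_ball_annulus, of x r "1/2"]
    by (simp only: overlap_def)
qed

lemma overlap_e1: "overlap x r = overlap (norm x *\<^sub>R e1) r"
  by (rule overlap_norm_cong) (simp add: norm_axis_1)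

lemma measure_less_of_open:
  fixes A B V :: "'a::euclidean_space set"
  assumes "A \<in> lmeasurable" "B \<in> lmeasurable" "A \<subseteq> B" "open V" "V \<noteq> {}" "V \<subseteq> B - A"
  shows "measure lebesgue A < measure lebesgue B"
proof -
  have "\<not> negligible V" using assms by (simp add: open_not_negligible)
  then have "\<not> negligible (B - A)"
    using negligible_subset assms(6) by blast
  then have "measure lebesgue (B - A) \<noteq> 0"
    using assms by (simp add: negligible_iff_measure fmeasurable.Diff)
  moreover have "measure lebesgue (B - A) = measure lebesgue B - measure lebesgue A"
    using assms by (simp add: measurable_measure_Diff)
  ultimately show ?thesis
    using measure_nonneg[of lebesgue "B - A"] by linarith
qed

lemma overlap_cover:
  assumes "norm x + 1 \<le> r"
  shows "overlap x r = 3 * pi / 4"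
proof -
  have "ball x r \<inter> annulus (1/2) = ball 0 1 - cball 0 (1/2)"
  proof -
    have "y \<in> ball x r" if "norm y < 1" for y
      using that assms norm_triangle_ineq4[of x y] by (simp add: dist_norm)
    then show ?thesis by (auto simp: annulus_def)
  qed
  then have "overlap x r = measure lebesgue (ball (0::real^2) 1) - measure lebesgue (cball (0::real^2) (1/2))"
    unfolding overlap_def by (simp add: measurable_measure_Diff subset_eq)
  then show ?thesis
    by (simp add: measure_disc measure_cdisc power2_eq_square)
qed

lemma overlap_hole:
  assumes "norm x + r \<le> 1/2"
  shows "overlap x r = 0"
proof -
  have "norm y \<le> 1/2" if "y \<in> ball x r" for y
    using that assms norm_triangle_ineq2[of y x] by (simp add: dist_norm norm_minus_commute)
  then have "ball x r \<inter> annulus (1/2) = {}"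
    by (force simp: annulus_def)
  then show ?thesis by (simp add: overlap_def)
qed

section \<open>Discs through the origin\<close>

text \<open>The derivative of \<open>arcsin\<close> at \<open>z\<close> is at most \<open>1 + 3/4 * z\<^sup>2\<close> on this range. The coefficient
  of \<open>z\<^sup>2\<close> in its Taylor series is \<open>1/2\<close>; the larger \<open>3/4\<close> absorbs the higher terms up to
  \<open>z = 3/5\<close>, which covers the cosines of the half-angles of arcs for discs whose bounding circle
  passes close to the origin and whose centre has norm at least \<open>1\<close>.\<close>

lemma arcsin_diff_le:
  fixes a b :: real
  assumes "0 \<le> a" "a \<le> b" "b \<le> 3/5"
  shows "arcsin b - arcsin a \<le> (b + b ^ 3 / 4) - (a + a ^ 3 / 4)"
proof -
  let ?h = "\<lambda>z::real. z + z ^ 3 / 4 - arcsin z"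
  have "?h a \<le> ?h b"
  proof (rule DERIV_nonneg_imp_nondecreasing[OF \<open>a \<le> b\<close>])
    fix z assume z: "a \<le> z" "z \<le> b"
    then have z': "0 \<le> z" "z \<le> 3/5" "-1 < z" "z < 1" using assms by auto
    have z2: "0 \<le> z\<^sup>2" "z\<^sup>2 \<le> 9/25"
      using z' power_mono[of z "3/5" 2] by (auto simp: power2_eq_square)
    define q where "q = z\<^sup>2"
    have q: "0 \<le> q" "q \<le> 9/25" using z2 by (auto simp: q_def)
    have "1 \<le> (1 + 3/4 * q)\<^sup>2 * (1 - q)"
    proof -
      have "15/16 * q + 9/16 * q * q \<le> 15/16 * (9/25) + 9/16 * (9/25) * (9/25)"
        using q by (intro add_mono mult_mono) auto
      then have "0 \<le> q * (1/2 - (15/16 * q + 9/16 * q * q))"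
        using q by (intro mult_nonneg_nonneg) auto
      moreover have "(1 + 3/4 * q)\<^sup>2 * (1 - q) = 1 + q * (1/2 - (15/16 * q + 9/16 * q * q))"
        by (simp add: power2_eq_square field_simps)
      ultimately show ?thesis by linarith
    qed
    then have "1 \<le> sqrt ((1 + 3/4 * q)\<^sup>2 * (1 - q))" by simp
    also have "\<dots> = (1 + 3/4 * q) * sqrt (1 - q)"
      using q by (simp add: real_sqrt_mult)
    finally have "inverse (sqrt (1 - q)) \<le> 1 + 3/4 * q"
      using q by (simp add: field_simps)
    moreover have "(?h has_real_derivative (1 + 3/4 * z\<^sup>2 - inverse (sqrt (1 - z\<^sup>2)))) (at z)"
      using z' by (auto intro!: derivative_eq_intros simp: power2_eq_square)
    ultimately show "\<exists>y. (?h has_real_derivative y) (at z) \<and> 0 \<le> y"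
      by (auto simp: q_def)
  qed
  then show ?thesis by simp
qed

lemma arcsin_ge_self: "0 \<le> z \<Longrightarrow> z \<le> 1 \<Longrightarrow> z \<le> arcsin z" for z :: real
  using sin_x_le_x[of "arcsin z"] arcsin_le_mono[of 0 z] by simp

lemma has_integral_FTC_real:
  fixes F :: "real \<Rightarrow> real"
  assumes "a \<le> b" "\<And>x. x \<in> {a..b} \<Longrightarrow> (F has_real_derivative f x) (at x)"
  shows "(f has_integral (F b - F a)) {a..b}"
  using assms
  by (intro fundamental_theorem_of_calculus)
    (auto simp: has_real_derivative_iff_has_vector_derivative[symmetric] intro: has_field_derivative_at_within)

lemma overlap_self_has_integral:
  fixes s :: real
  assumes "1/2 \<le> s"
  shows "((\<lambda>\<tau>. 2 * \<tau> * arccos (\<tau> / (2 * s))) has_integral overlap (s *\<^sub>R e1) s) {1/2..1}"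
proof -
  have "overlap (s *\<^sub>R e1) s = integral {1/2..1} (\<lambda>\<tau>. 2 * \<tau> * arccos ((\<tau>\<^sup>2 + (s\<^sup>2 - s\<^sup>2)) / (2 * s * \<tau>)))"
  proof (rule overlap_eq_integral)
    fix \<tau> :: real assume "\<tau> \<in> {1/2..1}"
    then have "\<tau> * \<tau> \<le> (2 * s) * \<tau>" "0 \<le> \<tau> * \<tau>"
      using assms by (intro mult_right_mono) auto
    then show "\<bar>\<tau>\<^sup>2 + (s\<^sup>2 - s\<^sup>2)\<bar> \<le> 2 * s * \<tau>" by (simp add: power2_eq_square)
  qed (use assms in auto)
  also have "\<dots> = integral {1/2..1} (\<lambda>\<tau>. 2 * \<tau> * arccos (\<tau> / (2 * s)))"
    by (intro integral_cong) (auto simp: power2_eq_square)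
  finally show ?thesis
    using assms
    by (auto simp: has_integral_iff intro!: integrable_continuous_interval continuous_intros) (auto simp: field_simps)
qed

text \<open>The leading term \<open>3 * pi / 8\<close> is half the area of the annulus, that is, the limit for a disc so
  large that its boundary is nearly a line through the origin; the correction is the effect of the
  curvature of that boundary.\<close>

lemma overlap_self_le:
  fixes s :: real
  assumes "1/2 \<le> s"
  shows "overlap (s *\<^sub>R e1) s \<le> 3 * pi / 8 - 7 / (24 * s)"
proof -
  have "((\<lambda>\<tau>. pi * \<tau> - \<tau>\<^sup>2 / s) has_integral
      (pi * 1\<^sup>2 / 2 - 1 ^ 3 / (3 * s)) - (pi * (1/2)\<^sup>2 / 2 - (1/2) ^ 3 / (3 * s))) {1/2..1}"
    using assms by (intro has_integral_FTC_real) (auto intro!: derivative_eq_intros simp: power2_eq_square field_simps)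
  with overlap_self_has_integral[OF assms]
  have "overlap (s *\<^sub>R e1) s \<le>
      (pi * 1\<^sup>2 / 2 - 1 ^ 3 / (3 * s)) - (pi * (1/2)\<^sup>2 / 2 - (1/2) ^ 3 / (3 * s))"
  proof (rule has_integral_le)
    fix \<tau> :: real assume \<tau>: "\<tau> \<in> {1/2..1}"
    have c: "0 \<le> \<tau> / (2 * s)" "\<tau> / (2 * s) \<le> 1"
      using \<tau> assms by (auto simp: field_simps)
    then have "arccos (\<tau> / (2 * s)) \<le> pi / 2 - \<tau> / (2 * s)"
      using arcsin_ge_self[OF c] by (simp add: arccos_arcsin_eq)
    then have "2 * \<tau> * arccos (\<tau> / (2 * s)) \<le> 2 * \<tau> * (pi / 2 - \<tau> / (2 * s))"
      using \<tau> by (intro mult_left_mono) auto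
    also have "\<dots> = pi * \<tau> - \<tau>\<^sup>2 / s"
      using assms by (simp add: field_simps power2_eq_square)
    finally show "2 * \<tau> * arccos (\<tau> / (2 * s)) \<le> pi * \<tau> - \<tau>\<^sup>2 / s" .
  qed
  also have "\<dots> = 3 * pi / 8 - 7 / (24 * s)"
    using assms by (simp add: field_simps power2_eq_square power3_eq_cube)
  finally show ?thesis .
qed

lemma overlap_self_ge:
  fixes s :: real
  assumes "1 \<le> s"
  shows "3 * pi / 8 - 7 / (24 * s) - 31 / (2560 * s ^ 3) \<le> overlap (s *\<^sub>R e1) s"
proof -
  have "((\<lambda>\<tau>. pi * \<tau> - \<tau>\<^sup>2 / s - \<tau> ^ 4 / (16 * s ^ 3)) has_integral
      (pi * 1\<^sup>2 / 2 - 1 ^ 3 / (3 * s) - 1 ^ 5 / (80 * s ^ 3)) -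
      (pi * (1/2)\<^sup>2 / 2 - (1/2) ^ 3 / (3 * s) - (1/2) ^ 5 / (80 * s ^ 3))) {1/2..1}"
    using assms by (intro has_integral_FTC_real) (auto intro!: derivative_eq_intros simp: power2_eq_square field_simps)
  from this overlap_self_has_integral
  have "(pi * 1\<^sup>2 / 2 - 1 ^ 3 / (3 * s) - 1 ^ 5 / (80 * s ^ 3)) -
      (pi * (1/2)\<^sup>2 / 2 - (1/2) ^ 3 / (3 * s) - (1/2) ^ 5 / (80 * s ^ 3)) \<le> overlap (s *\<^sub>R e1) s"
  proof (rule has_integral_le)
    fix \<tau> :: real assume \<tau>: "\<tau> \<in> {1/2..1}"
    have c: "0 \<le> \<tau> / (2 * s)" "\<tau> / (2 * s) \<le> 3/5"
      using \<tau> assms by (auto simp: field_simps)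
    then have "arccos (\<tau> / (2 * s)) \<ge> pi / 2 - \<tau> / (2 * s) - (\<tau> / (2 * s)) ^ 3 / 4"
      using arcsin_diff_le[of 0 "\<tau> / (2 * s)"] by (simp add: arccos_arcsin_eq)
    then have "2 * \<tau> * (pi / 2 - \<tau> / (2 * s) - (\<tau> / (2 * s)) ^ 3 / 4) \<le> 2 * \<tau> * arccos (\<tau> / (2 * s))"
      using \<tau> by (intro mult_left_mono) auto
    moreover have "2 * \<tau> * (pi / 2 - \<tau> / (2 * s) - (\<tau> / (2 * s)) ^ 3 / 4)
        = pi * \<tau> - \<tau>\<^sup>2 / s - \<tau> ^ 4 / (16 * s ^ 3)"
      using assms by (simp add: field_simps eval_nat_numeral)
    ultimately show "pi * \<tau> - \<tau>\<^sup>2 / s - \<tau> ^ 4 / (16 * s ^ 3) \<le> 2 * \<tau> * arccos (\<tau> / (2 * s))"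
      by simp
  qed (use assms in auto)
  moreover have "(pi * 1\<^sup>2 / 2 - 1 ^ 3 / (3 * s) - 1 ^ 5 / (80 * s ^ 3)) -
      (pi * (1/2)\<^sup>2 / 2 - (1/2) ^ 3 / (3 * s) - (1/2) ^ 5 / (80 * s ^ 3)) =
      3 * pi / 8 - 7 / (24 * s) - 31 / (2560 * s ^ 3)"
    using assms by (simp add: field_simps eval_nat_numeral)
  ultimately show ?thesis by simp
qed

text \<open>For centres of norm between \<open>1\<close> and \<open>49/25\<close>, a smaller proportion of the circle through the
  origin lies in the annulus than of the disc that it bounds, so shrinking the disc slightly raises
  the average. With \<open>\<rho>\<^sup>2 = s\<^sup>2 - w\<close>, the polar formula bounds the lost area by \<open>w / s\<close> times the integral of
  \<open>1 + 3/4 * (c \<tau>)\<^sup>2\<close>, where \<open>c \<tau>\<close> is the cosine of the half-angle of the arc at radius \<open>\<tau>\<close>; the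
  factor \<open>w\<close> cancels and the claim becomes a lower bound on the area before shrinking.\<close>

lemma shrinking_gains_near_outside:
  fixes s :: real
  assumes s: "1 \<le> s" "s \<le> 49/25"
  defines "\<rho> \<equiv> sqrt (s\<^sup>2 - 1/1000)"
  shows "overlap (s *\<^sub>R e1) s * \<rho>\<^sup>2 < overlap (s *\<^sub>R e1) \<rho> * s\<^sup>2" "0 < \<rho>" "\<rho> \<noteq> s"
proof -
  \<comment> \<open>small enough for \<open>c \<tau>\<close> below to be close to \<open>\<tau> / (2 * s)\<close>, its value for the disc through the origin\<close>
  define w :: real where "w = 1/1000"
  have s2: "1 \<le> s\<^sup>2" using s by simp
  have \<rho>2: "\<rho>\<^sup>2 = s\<^sup>2 - w" using s2 by (simp add: \<rho>_def w_def)
  show "0 < \<rho>" using s2 by (simp add: \<rho>_def)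
  show "\<rho> \<noteq> s" using \<rho>2 by (auto simp: w_def)
  define M where "M = overlap (s *\<^sub>R e1) s"
  define c where "c \<tau> = (\<tau>\<^sup>2 + w) / (2 * s * \<tau>)" for \<tau>
  have c_le: "c \<tau> \<le> 3/5" "0 \<le> c \<tau>" "\<tau> / (2 * s) \<le> c \<tau>" "(c \<tau>)\<^sup>2 \<le> (\<tau>\<^sup>2 + 1/400) / (4 * s\<^sup>2)"
    if \<tau>: "\<tau> \<in> {1/2..1}" for \<tau>
  proof -
    have eq: "c \<tau> = (\<tau> + w / \<tau>) / (2 * s)"
      using \<tau> s by (simp add: c_def field_simps power2_eq_square)
    have u: "0 \<le> w / \<tau>" "w / \<tau> \<le> 1/500"
      using \<tau> by (auto simp: w_def field_simps)
    have "\<tau> \<le> 1" "1 + 1/500 \<le> (3/5) * (2 * s)"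
      using \<tau> s by auto
    with u(2) have "\<tau> + w / \<tau> \<le> (3/5) * (2 * s)"
      by linarith
    then show "c \<tau> \<le> 3/5"
      using s by (simp add: eq field_simps)
    show "0 \<le> c \<tau>" "\<tau> / (2 * s) \<le> c \<tau>"
      using u \<tau> s by (auto simp: eq intro!: divide_right_mono)
    have "(\<tau> + w / \<tau>)\<^sup>2 = \<tau>\<^sup>2 + 2 * w + (w / \<tau>)\<^sup>2"
      using \<tau> by (simp add: power2_eq_square field_simps)
    moreover have "(w / \<tau>)\<^sup>2 \<le> (1/500)\<^sup>2"
      using u by (intro power_mono) auto
    ultimately have "(\<tau> + w / \<tau>)\<^sup>2 \<le> \<tau>\<^sup>2 + 1/400"
      by (simp add: w_def power2_eq_square)
    then show "(c \<tau>)\<^sup>2 \<le> (\<tau>\<^sup>2 + 1/400) / (4 * s\<^sup>2)"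
      by (simp add: eq power_divide power_mult_distrib divide_right_mono)
  qed
  have "overlap (s *\<^sub>R e1) \<rho> = integral {1/2..1} (\<lambda>\<tau>. 2 * \<tau> * arccos ((\<tau>\<^sup>2 + (s\<^sup>2 - \<rho>\<^sup>2)) / (2 * s * \<tau>)))"
  proof (rule overlap_eq_integral)
    fix \<tau> :: real assume \<tau>: "\<tau> \<in> {1/2..1}"
    have "c \<tau> \<le> 1" using c_le(1)[OF \<tau>] by simp
    then have "\<tau>\<^sup>2 + w \<le> 2 * s * \<tau>"
      using \<tau> s by (simp add: c_def field_simps)
    then show "\<bar>\<tau>\<^sup>2 + (s\<^sup>2 - \<rho>\<^sup>2)\<bar> \<le> 2 * s * \<tau>"
      by (simp add: \<rho>2 w_def)
  qed (use s \<open>0 < \<rho>\<close> in auto)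
  then have "overlap (s *\<^sub>R e1) \<rho> = integral {1/2..1} (\<lambda>\<tau>. 2 * \<tau> * arccos (c \<tau>))"
    by (simp add: \<rho>2 c_def)
  moreover have "continuous_on {1/2..1} (\<lambda>\<tau>. 2 * \<tau> * arccos (c \<tau>))"
  proof -
    have "\<forall>\<tau>\<in>{1/2..1}. - 1 \<le> c \<tau> \<and> c \<tau> \<le> 1"
      using c_le(1,2) by force
    then show ?thesis
      using s unfolding c_def by (intro continuous_intros) auto
  qed
  ultimately have "((\<lambda>\<tau>. 2 * \<tau> * arccos (c \<tau>)) has_integral overlap (s *\<^sub>R e1) \<rho>) {1/2..1}"
    by (simp add: has_integral_iff integrable_continuous_interval)
  from has_integral_diff[OF overlap_self_has_integral this]
  have 1: "((\<lambda>\<tau>. 2 * \<tau> * arccos (\<tau> / (2 * s)) - 2 * \<tau> * arccos (c \<tau>)) has_integral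
      M - overlap (s *\<^sub>R e1) \<rho>) {1/2..1}"
    using s by (simp add: M_def)
  have 2: "((\<lambda>\<tau>. w / s * (1 + k * (\<tau>\<^sup>2 + 1/400))) has_integral
      w / s * (1 + k * (1 ^ 3 / 3 + 1/400)) -
      w / s * (1/2 + k * ((1/2) ^ 3 / 3 + 1/2/400))) {1/2..1}" for k
    using s by (intro has_integral_FTC_real) (auto intro!: derivative_eq_intros simp: power2_eq_square)
  have "M - overlap (s *\<^sub>R e1) \<rho> \<le>
      w / s * (1 + 3 / (16 * s\<^sup>2) * (1 ^ 3 / 3 + 1/400)) -
      w / s * (1/2 + 3 / (16 * s\<^sup>2) * ((1/2) ^ 3 / 3 + 1/2/400))"
    using 1 2
  proof (rule has_integral_le)
    fix \<tau> :: real assume \<tau>: "\<tau> \<in> {1/2..1}"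
    define a where "a = \<tau> / (2 * s)"
    note c = c_le[OF \<tau>]
    have a: "0 \<le> a" "a \<le> c \<tau>" using c \<tau> s by (auto simp: a_def)
    have "arccos a - arccos (c \<tau>) = arcsin (c \<tau>) - arcsin a"
      using a c by (simp add: arccos_arcsin_eq)
    also have "\<dots> \<le> (c \<tau> + (c \<tau>) ^ 3 / 4) - (a + a ^ 3 / 4)"
      using a c by (intro arcsin_diff_le) auto
    also have "\<dots> = (c \<tau> - a) * (1 + ((c \<tau>)\<^sup>2 + c \<tau> * a + a\<^sup>2) / 4)"
      by (simp add: power2_eq_square power3_eq_cube field_simps)
    also have "\<dots> \<le> (c \<tau> - a) * (1 + 3 / 4 * (c \<tau>)\<^sup>2)"
    proof (intro mult_left_mono)
      have "c \<tau> * a \<le> c \<tau> * c \<tau>" "a * a \<le> c \<tau> * c \<tau>"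
        using a by (auto intro!: mult_mono)
      then show "1 + ((c \<tau>)\<^sup>2 + c \<tau> * a + a\<^sup>2) / 4 \<le> 1 + 3 / 4 * (c \<tau>)\<^sup>2"
        by (simp add: power2_eq_square)
    qed (use a in auto)
    also have "\<dots> \<le> (c \<tau> - a) * (1 + 3 / 4 * ((\<tau>\<^sup>2 + 1/400) / (4 * s\<^sup>2)))"
      using c(4) a by (intro mult_left_mono add_left_mono) auto
    also have "c \<tau> - a = w / (2 * s * \<tau>)"
      using \<tau> s by (simp add: c_def a_def field_simps power2_eq_square)
    finally have "2 * \<tau> * (arccos a - arccos (c \<tau>)) \<le>
        2 * \<tau> * (w / (2 * s * \<tau>) * (1 + 3 / 4 * ((\<tau>\<^sup>2 + 1/400) / (4 * s\<^sup>2))))"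
      using \<tau> by (intro mult_left_mono) auto
    also have "\<dots> = w / s * (1 + 3 / (16 * s\<^sup>2) * (\<tau>\<^sup>2 + 1/400))"
      using \<tau> s by simp
    finally show "2 * \<tau> * arccos (\<tau> / (2 * s)) - 2 * \<tau> * arccos (c \<tau>) \<le>
        w / s * (1 + 3 / (16 * s\<^sup>2) * (\<tau>\<^sup>2 + 1/400))"
      by (simp add: a_def algebra_simps)
  qed
  also have "\<dots> = w / s * (1/2 + 3 / (16 * s\<^sup>2) * (7/24 + 1/800))"
    by (simp add: algebra_simps power_divide)
  finally have "s\<^sup>2 * (M - overlap (s *\<^sub>R e1) \<rho>) \<le> s\<^sup>2 * (w / s * (1/2 + 3 / (16 * s\<^sup>2) * (7/24 + 1/800)))"
    by (intro mult_left_mono) auto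
  also have "\<dots> = w * (s / 2 + 3 / (16 * s) * (7/24 + 1/800))"
    using s by (simp add: field_simps power2_eq_square)
  also have "\<dots> < w * M"
  proof (intro mult_strict_left_mono)
    have "s / 2 + 3 / (16 * s) * (7/24 + 1/800) < 3 * pi / 8 - 7 / (24 * s) - 31 / (2560 * s ^ 3)"
    proof -
      have "s\<^sup>2 / 2 + 3/16 * (7/24 + 1/800) + 7/24 + 31/2560 < 3 * 3.14 / 8 * s"
      proof -
        \<comment> \<open>by convexity, the quadratic lies below its chord over the interval\<close>
        have "(s - 1) * (s - 49/25) \<le> 0"
          using s by (intro mult_nonneg_nonpos) auto
        moreover have "(s - 1) * (s - 49/25) = s\<^sup>2 - (74/25 * s - 49/25)"
          by (simp add: power2_eq_square field_simps)
        ultimately have "s\<^sup>2 \<le> 74/25 * s - 49/25"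
          by linarith
        with s show ?thesis by simp
      qed
      also have "\<dots> \<le> 3 * pi / 8 * s"
        using pi_approx s by (intro mult_right_mono) auto
      finally have *: "s\<^sup>2 / 2 + 3/16 * (7/24 + 1/800) + 7/24 + 31/2560 < 3 * pi / 8 * s" .
      have "31 / (2560 * s\<^sup>2) \<le> 31/2560"
        using s2 s by (intro divide_left_mono) auto
      with * have "s\<^sup>2 / 2 + 3/16 * (7/24 + 1/800) < 3 * pi / 8 * s - 7/24 - 31 / (2560 * s\<^sup>2)"
        by linarith
      then have "(s\<^sup>2 / 2 + 3/16 * (7/24 + 1/800)) / s < (3 * pi / 8 * s - 7/24 - 31 / (2560 * s\<^sup>2)) / s"
        using s by (intro divide_strict_right_mono) auto
      moreover have "(s\<^sup>2 / 2 + 3/16 * (7/24 + 1/800)) / s = s / 2 + 3 / (16 * s) * (7/24 + 1/800)"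
        using s by (simp add: field_simps power2_eq_square)
      moreover have "(3 * pi / 8 * s - 7/24 - 31 / (2560 * s\<^sup>2)) / s
          = 3 * pi / 8 - 7 / (24 * s) - 31 / (2560 * s ^ 3)"
        using s by (simp add: diff_divide_distrib power2_eq_square power3_eq_cube mult_ac)
      ultimately show ?thesis by simp
    qed
    also have "\<dots> \<le> M"
      unfolding M_def by (rule overlap_self_ge[OF s(1)])
    finally show "s / 2 + 3 / (16 * s) * (7/24 + 1/800) < M" .
  qed (simp add: w_def)
  finally show "overlap (s *\<^sub>R e1) s * \<rho>\<^sup>2 < overlap (s *\<^sub>R e1) \<rho> * s\<^sup>2"
    unfolding \<rho>2 by (simp add: M_def[symmetric] algebra_simps)
qed


text \<open>The antiderivative is explicit here; the estimate in the following lemma has little room, so the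
  exact value is used in place of a bound.\<close>

lemma overlap_self_half: "overlap ((1/2) *\<^sub>R e1) (1/2) = pi / 12 + sqrt (3/4) / 4"
proof -
  define F where "F \<tau> = \<tau>\<^sup>2 * arccos \<tau> + (arcsin \<tau> - \<tau> * sqrt (1 - \<tau>\<^sup>2)) / 2" for \<tau> :: real
  have "((\<lambda>\<tau>. 2 * \<tau> * arccos \<tau>) has_integral (F 1 - F (1/2))) {1/2..1}"
  proof (rule fundamental_theorem_of_calculus_interior)
    show "continuous_on {1/2..1} F"
      unfolding F_def by (intro continuous_intros) auto
    fix \<tau> :: real assume \<tau>: "\<tau> \<in> {1/2<..<1}"
    then have lt: "\<tau>\<^sup>2 < 1"
      by (simp add: power2_less_1_iff)
    define q where "q = sqrt (1 - \<tau>\<^sup>2)"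
    have q: "0 < q" "q * q = 1 - \<tau> * \<tau>"
      using lt by (auto simp: q_def power2_eq_square simp flip: real_sqrt_mult)
    have "(F has_real_derivative 2 * \<tau> * arccos \<tau> + \<tau>\<^sup>2 * inverse (- q) +
        (inverse q - (q + \<tau> * (inverse q / 2 * (- (2 * \<tau>))))) / 2) (at \<tau>)"
      unfolding F_def q_def using \<tau> lt
      by (auto intro!: derivative_eq_intros simp: power2_eq_square)
    moreover have "2 * \<tau> * arccos \<tau> + \<tau>\<^sup>2 * inverse (- q) +
        (inverse q - (q + \<tau> * (inverse q / 2 * (- (2 * \<tau>))))) / 2 = 2 * \<tau> * arccos \<tau>"
    proof -
      have "q * (\<tau> * \<tau> + q * q) = q" using q by simp
      then show ?thesis
        using q(1) by (simp add: field_simps power2_eq_square)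
    qed
    ultimately show "(F has_vector_derivative 2 * \<tau> * arccos \<tau>) (at \<tau>)"
      by (simp add: has_real_derivative_iff_has_vector_derivative[symmetric])
  qed auto
  moreover have "((\<lambda>\<tau>. 2 * \<tau> * arccos \<tau>) has_integral overlap ((1/2) *\<^sub>R e1) (1/2)) {1/2..1}"
    using overlap_self_has_integral[of "1/2"] by simp
  ultimately have "overlap ((1/2) *\<^sub>R e1) (1/2) = F 1 - F (1/2)"
    using has_integral_unique by blast
  moreover have "arcsin (1/2) = pi / 6"
    using arcsin_sin[of "pi / 6"] by (simp add: sin_30)
  moreover have "arccos (1/2) = pi / 3"
    using arccos_cos[of "pi / 3"] by (simp add: cos_60)
  ultimately show ?thesis
    by (simp add: F_def power2_eq_square field_simps)
qed

text \<open>The delicate case: the centre lies on the inner circle of the annulus and the disc through the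
  origin touches the outer circle from inside. Growing the disc gains from the annulus until the part
  beyond the outer circle takes over, which happens for a radius only slightly above \<open>1/2\<close>.
  With \<open>\<rho>\<^sup>2 = 1/4 + v\<close>, the polar formula bounds the gained area below by
  \<open>2 * v * (arcsin (1 - 2 * v) - arcsin (1/2 - 2 * v))\<close>, which for small \<open>v\<close> is close to
  \<open>2 * v * pi / 3\<close>, whereas the average is already
  preserved if the gain is \<open>4 * v\<close> times the area before growth.\<close>

lemma growing_gains_half:
  obtains \<rho> :: real where "1/2 < \<rho>"
    "overlap ((1/2) *\<^sub>R e1) (1/2) * \<rho>\<^sup>2 < overlap ((1/2) *\<^sub>R e1) \<rho> * (1/2)\<^sup>2"
proof -
  \<comment> \<open>chosen so that \<open>arcsin (1 - 2 * v)\<close> is explicit and close enough to \<open>pi / 2\<close>\<close>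
  define v where "v = (1 - sin (49/100 * pi)) / 2"
  have "sin (pi / 6) \<le> sin (49/100 * pi)"
    by (intro sin_monotone_2pi_le) auto
  moreover have "sin (49/100 * pi) < sin (pi / 2)"
    by (intro sin_monotone_2pi) auto
  ultimately have v: "0 < v" "v \<le> 1/4"
    by (auto simp: v_def sin_30)
  define \<rho> where "\<rho> = sqrt ((1/2)\<^sup>2 + v)"
  have \<rho>2: "\<rho>\<^sup>2 = (1/2)\<^sup>2 + v"
    using v by (simp add: \<rho>_def)
  have "sqrt ((1/2)\<^sup>2) < \<rho>"
    unfolding \<rho>_def using v by (intro real_sqrt_less_mono) auto
  then have \<rho>: "1/2 < \<rho>" by simp
  define M where "M = overlap ((1/2) *\<^sub>R e1) (1/2)"
  define c where "c \<tau> = \<tau> - v / \<tau>" for \<tau>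
  have c: "0 \<le> c \<tau>" "\<tau> - 2 * v \<le> c \<tau>" "c \<tau> < \<tau>" if \<tau>: "\<tau> \<in> {1/2..1}" for \<tau>
  proof -
    have "v / \<tau> \<le> v / (1/2)"
      using \<tau> v by (intro divide_left_mono) auto
    then show "0 \<le> c \<tau>" "\<tau> - 2 * v \<le> c \<tau>" "c \<tau> < \<tau>"
      using v \<tau> by (auto simp: c_def)
  qed
  have "overlap ((1/2) *\<^sub>R e1) \<rho> = integral {1/2..1} (\<lambda>\<tau>. 2 * \<tau> * arccos ((\<tau>\<^sup>2 + ((1/2)\<^sup>2 - \<rho>\<^sup>2)) / (2 * (1/2) * \<tau>)))"
  proof (rule overlap_eq_integral)
    fix \<tau> :: real assume \<tau>: "\<tau> \<in> {1/2..1}"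
    define q where "q = \<tau>\<^sup>2"
    have "q \<le> \<tau>" "1/4 \<le> q"
      using \<tau> mult_right_mono[of \<tau> 1 \<tau>] mult_mono[of "1/2" \<tau> "1/2" \<tau>]
      by (auto simp: q_def power2_eq_square)
    then show "\<bar>\<tau>\<^sup>2 + ((1/2)\<^sup>2 - \<rho>\<^sup>2)\<bar> \<le> 2 * (1/2) * \<tau>"
      using v \<tau> unfolding \<rho>2 abs_le_iff q_def[symmetric] by simp
  qed (use \<rho> in auto)
  also have "\<dots> = integral {1/2..1} (\<lambda>\<tau>. 2 * \<tau> * arccos (c \<tau>))"
    unfolding \<rho>2 by (intro integral_cong) (auto simp: c_def field_simps power2_eq_square)
  finally have "overlap ((1/2) *\<^sub>R e1) \<rho> = integral {1/2..1} (\<lambda>\<tau>. 2 * \<tau> * arccos (c \<tau>))" .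
  moreover have "continuous_on {1/2..1} (\<lambda>\<tau>. 2 * \<tau> * arccos (c \<tau>))"
  proof -
    have "\<forall>\<tau>\<in>{1/2..1}. - 1 \<le> c \<tau> \<and> c \<tau> \<le> 1"
      using c by force
    then show ?thesis
      unfolding c_def by (intro continuous_intros) auto
  qed
  ultimately have "((\<lambda>\<tau>. 2 * \<tau> * arccos (c \<tau>)) has_integral overlap ((1/2) *\<^sub>R e1) \<rho>) {1/2..1}"
    by (simp add: has_integral_iff integrable_continuous_interval)
  from has_integral_diff[OF this overlap_self_has_integral[of "1/2"]]
  have 1: "((\<lambda>\<tau>. 2 * \<tau> * arccos (c \<tau>) - 2 * \<tau> * arccos \<tau>) has_integral
      overlap ((1/2) *\<^sub>R e1) \<rho> - M) {1/2..1}"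
    by (simp add: M_def)
  have 2: "((\<lambda>\<tau>. 2 * v * inverse (sqrt (1 - (\<tau> - 2 * v)\<^sup>2))) has_integral
      2 * v * arcsin (1 - 2 * v) - 2 * v * arcsin (1/2 - 2 * v)) {1/2..1}"
    using v by (intro has_integral_FTC_real) (auto intro!: derivative_eq_intros)
  have "2 * v * arcsin (1 - 2 * v) - 2 * v * arcsin (1/2 - 2 * v) \<le> overlap ((1/2) *\<^sub>R e1) \<rho> - M"
    using 2 1
  proof (rule has_integral_le)
    fix \<tau> :: real assume \<tau>: "\<tau> \<in> {1/2..1}"
    note c = c[OF \<tau>]
    have "\<exists>l z. c \<tau> < z \<and> z < \<tau> \<and> (arcsin has_real_derivative l) (at z) \<and>
        arcsin \<tau> - arcsin (c \<tau>) = (\<tau> - c \<tau>) * l"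
    proof (rule MVT)
      show "continuous_on {c \<tau>..\<tau>} arcsin"
        using c \<tau> by (intro continuous_on_arcsin' [THEN continuous_on_subset]) auto
      show "arcsin differentiable (at x)" if "c \<tau> < x" "x < \<tau>" for x
        using DERIV_arcsin[of x] that c \<tau> by (force simp: real_differentiable_def)
    qed (use c in auto)
    then obtain l z where z: "c \<tau> < z" "z < \<tau>" "(arcsin has_real_derivative l) (at z)"
        "arcsin \<tau> - arcsin (c \<tau>) = (\<tau> - c \<tau>) * l"
      by blast
    have z1: "- 1 < z" "z < 1" "0 < z" using z c \<tau> by auto
    have l: "l = inverse (sqrt (1 - z\<^sup>2))"
      using DERIV_unique[OF z(3) DERIV_arcsin[OF z1(1,2)]] .
    have "inverse (sqrt (1 - (\<tau> - 2 * v)\<^sup>2)) \<le> l"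
      unfolding l
    proof (intro le_imp_inverse_le real_sqrt_le_mono)
      show "0 < sqrt (1 - z\<^sup>2)" using z1 by (simp add: power2_less_1_iff)
      have "(\<tau> - 2 * v)\<^sup>2 \<le> z\<^sup>2"
        using v \<tau> z c by (intro power_mono) auto
      then show "1 - z\<^sup>2 \<le> 1 - (\<tau> - 2 * v)\<^sup>2" by simp
    qed
    then have "2 * v * inverse (sqrt (1 - (\<tau> - 2 * v)\<^sup>2)) \<le> 2 * v * l"
      using v by (intro mult_left_mono) auto
    also have "\<dots> = 2 * \<tau> * (arcsin \<tau> - arcsin (c \<tau>))"
      using \<tau> by (simp add: z(4)) (simp add: c_def)
    also have "\<dots> = 2 * \<tau> * arccos (c \<tau>) - 2 * \<tau> * arccos \<tau>"
      using c \<tau> by (simp add: arccos_arcsin_eq algebra_simps)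
    finally show "2 * v * inverse (sqrt (1 - (\<tau> - 2 * v)\<^sup>2)) \<le> 2 * \<tau> * arccos (c \<tau>) - 2 * \<tau> * arccos \<tau>" .
  qed
  moreover have "2 * v * (49/100 * pi) - 2 * v * (pi / 6)
      \<le> 2 * v * arcsin (1 - 2 * v) - 2 * v * arcsin (1/2 - 2 * v)"
  proof -
    have "1 - 2 * v = sin (49/100 * pi)" by (simp add: v_def field_simps)
    moreover have "arcsin (sin (49/100 * pi)) = 49/100 * pi"
      by (rule arcsin_sin) auto
    ultimately have "arcsin (1 - 2 * v) = 49/100 * pi" by (simp only:)
    moreover have "arcsin (1/2 - 2 * v) \<le> arcsin (1/2)"
      using v by (intro arcsin_le_arcsin) auto
    moreover have "arcsin (1/2) = pi / 6"
      using arcsin_sin[of "pi / 6"] by (simp add: sin_30)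
    ultimately have "49/100 * pi - pi / 6 \<le> arcsin (1 - 2 * v) - arcsin (1/2 - 2 * v)"
      by linarith
    then have "2 * v * (49/100 * pi - pi / 6) \<le> 2 * v * (arcsin (1 - 2 * v) - arcsin (1/2 - 2 * v))"
      using v by (intro mult_left_mono) auto
    then show ?thesis by (simp only: right_diff_distrib)
  qed
  moreover have "4 * v * M < 2 * v * (49/100 * pi) - 2 * v * (pi / 6)"
  proof -
    have "sqrt (3/4) \<le> 87/100"
      by (rule real_le_lsqrt) (auto simp: power2_eq_square)
    then have "2 * M < 49/100 * pi - pi / 6"
      using pi_gt3 by (simp add: M_def overlap_self_half)
    then have "2 * v * (2 * M) < 2 * v * (49/100 * pi - pi / 6)"
      using v by (intro mult_strict_left_mono) auto
    then show ?thesis by (simp add: algebra_simps)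
  qed
  ultimately have "4 * v * M < overlap ((1/2) *\<^sub>R e1) \<rho> - M"
    by linarith
  then have "M * \<rho>\<^sup>2 < overlap ((1/2) *\<^sub>R e1) \<rho> * (1/2)\<^sup>2"
    unfolding \<rho>2 by (simp add: power2_eq_square algebra_simps)
  with \<rho> that show thesis by (simp add: M_def)
qed

text \<open>As long as the disc stays inside the unit disc, only the hole matters. The closed hole is convex and
  contains the centre of the disc, so contracting the larger disc onto the smaller one maps hole points
  to hole points: the proportion of the disc taken by the hole cannot grow with the radius. It drops
  strictly because some points outside the hole are contracted into its interior.\<close>

lemma growing_gains_inside:
  fixes s :: real
  assumes s: "0 < s" "s < 1/2"
  shows "overlap (s *\<^sub>R e1) s * (1 - s)\<^sup>2 < overlap (s *\<^sub>R e1) (1 - s) * s\<^sup>2"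
proof -
  define x where "x = s *\<^sub>R e1"
  define \<rho> where "\<rho> = 1 - s"
  define k where "k = s / \<rho>"
  have nx: "norm x = s" using s by (simp add: x_def norm_axis_1)
  have k: "0 < k" "k < 1" "0 < \<rho>" "k * \<rho> = s" using s by (auto simp: k_def \<rho>_def)
  define T where "T y = k *\<^sub>R y + (1 - k) *\<^sub>R x" for y :: "real^2"
  have inner: "ball x r \<inter> annulus (1/2) = ball x r - cball 0 (1/2)" if "r \<le> \<rho>" for r
  proof -
    have "norm y < 1" if "y \<in> ball x r" for y
      using that \<open>r \<le> \<rho>\<close> norm_triangle_ineq2[of y x] by (simp add: dist_norm norm_minus_commute nx \<rho>_def)
    then show ?thesis by (auto simp: annulus_def)
  qed
  have Tdist: "dist x (T y) = k * dist x y" for y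
  proof -
    have "x - T y = k *\<^sub>R (x - y)" by (simp add: T_def algebra_simps)
    then show ?thesis using k by (simp add: dist_norm)
  qed
  have inv: "T ((1/k) *\<^sub>R z - ((1 - k)/k) *\<^sub>R x) = z" for z
  proof -
    have "k *\<^sub>R ((1/k) *\<^sub>R z - ((1 - k)/k) *\<^sub>R x) = z - (1 - k) *\<^sub>R x"
      using k by (simp add: scaleR_diff_right)
    then show ?thesis by (simp add: T_def)
  qed
  define A where "A = ball x s - cball 0 (1/2)"
  define B where "B = ball x \<rho> - cball 0 (1/2)"
  have openT: "open (T ` B)"
    unfolding T_def B_def
    using open_affinity[of "ball x \<rho> - cball 0 (1/2)" k "(1 - k) *\<^sub>R x"] k
    by (simp add: add.commute open_Diff)
  have mB: "B \<in> lmeasurable"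
    unfolding B_def by (intro lmeasurable_open open_Diff) (auto intro: bounded_subset[OF bounded_ball])
  have mT: "measure lebesgue (T ` B) = k\<^sup>2 * measure lebesgue B"
    using measure_lebesgue_affine[of k "(1 - k) *\<^sub>R x" B] k
    by (simp add: T_def[abs_def] add.commute power2_eq_square)
  have TB: "T ` B \<subseteq> ball x s"
  proof
    fix z assume "z \<in> T ` B"
    then obtain y where y: "z = T y" "dist x y < \<rho>" by (auto simp: B_def)
    then have "k * dist x y < k * \<rho>" using k by (intro mult_strict_left_mono)
    then show "z \<in> ball x s" by (simp only: mem_ball y Tdist k(4))
  qed
  have "A \<subseteq> T ` B"
  proof
    fix z assume z: "z \<in> A"
    define y where "y = (1/k) *\<^sub>R z - ((1 - k)/k) *\<^sub>R x"
    have Ty: "T y = z" unfolding y_def by (rule inv)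
    have "dist x (T y) < s" using z Ty by (simp add: A_def)
    then have "k * dist x y < k * \<rho>" by (simp only: Tdist k(4))
    then have "y \<in> ball x \<rho>" using k(1) by (simp only: mem_ball mult_less_cancel_left_pos)
    moreover have "y \<notin> cball 0 (1/2)"
    proof
      assume "y \<in> cball 0 (1/2)"
      moreover have "x \<in> cball 0 (1/2)" using nx s by simp
      ultimately have "T y \<in> cball 0 (1/2)"
        unfolding T_def using k convex_cball[of 0 "1/2"] by (intro convexD) auto
      then show False using z by (simp add: Ty A_def)
    qed
    ultimately show "z \<in> T ` B" using Ty by (auto simp: B_def)
  qed
  moreover have "T ` B \<inter> ball 0 (1/2) \<noteq> {}"
  proof -
    \<comment> \<open>in units of the radius, the point at signed distance \<open>1 - 2 * s\<close> from the centre lies outside the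
      hole in the larger disc and inside it in the smaller one\<close>
    define y where "y = (s + \<rho> * (1 - 2 * s)) *\<^sub>R e1"
    have pos: "0 < (1 - s) * (1 - 2 * s)" "0 < s * (1 - 2 * s)"
      using s by auto
    have ny: "norm y = s + \<rho> * (1 - 2 * s)"
      using s pos by (simp add: y_def norm_axis_1 \<rho>_def)
    have "1/2 * (1 - 2 * s) < \<rho> * (1 - 2 * s)" "s * (1 - 2 * s) < 1/2 * (1 - 2 * s)" "\<rho> * (1 - 2 * s) < \<rho> * 1"
      using s by (auto simp: \<rho>_def intro!: mult_strict_right_mono mult_strict_left_mono)
    moreover have "dist x y = \<rho> * (1 - 2 * s)"
    proof -
      have "y - x = (\<rho> * (1 - 2 * s)) *\<^sub>R e1" by (simp add: y_def x_def algebra_simps)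
      then show ?thesis using s pos by (simp add: dist_norm norm_minus_commute[of x] norm_axis_1 \<rho>_def)
    qed
    ultimately have "y \<in> B" by (simp add: B_def ny)
    moreover have "T y \<in> ball 0 (1/2)"
    proof -
      have "T y = (s + s * (1 - 2 * s)) *\<^sub>R e1"
      proof -
        have "k * (s + \<rho> * (1 - 2 * s)) + (1 - k) * s = s + (k * \<rho>) * (1 - 2 * s)"
          by (simp add: algebra_simps)
        then show ?thesis
          by (simp add: T_def y_def x_def k(4) flip: scaleR_add_left)
      qed
      moreover have "0 \<le> s + s * (1 - 2 * s)" using s pos by simp
      moreover have "s + s * (1 - 2 * s) < 1/2"
        using \<open>s * (1 - 2 * s) < 1/2 * (1 - 2 * s)\<close> by simp
      ultimately show ?thesis by (simp add: norm_axis_1)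
    qed
    ultimately show ?thesis by blast
  qed
  ultimately have "measure lebesgue A < measure lebesgue (T ` B)"
  proof (intro measure_less_of_open[where V = "T ` B \<inter> ball 0 (1/2)"])
    show "A \<in> lmeasurable"
      unfolding A_def by (intro lmeasurable_open open_Diff) (auto intro: bounded_subset[OF bounded_ball])
    show "T ` B \<in> lmeasurable"
      using openT TB by (intro lmeasurable_open) (auto intro: bounded_subset[OF bounded_ball])
  qed (use openT in \<open>auto simp: A_def\<close>)
  then have "measure lebesgue A * \<rho>\<^sup>2 < k\<^sup>2 * measure lebesgue B * \<rho>\<^sup>2"
    using k by (simp add: mT)
  also have "\<dots> = measure lebesgue B * (k * \<rho>)\<^sup>2"
    by (simp add: power_mult_distrib)
  finally have "measure lebesgue A * \<rho>\<^sup>2 < measure lebesgue B * s\<^sup>2"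
    by (simp add: k)
  then show ?thesis
    using inner[of s] inner[of \<rho>] s by (simp add: overlap_def A_def B_def x_def \<rho>_def)
qed

text \<open>A small disc about a point of the annulus has average \<open>1\<close>, whereas the disc through the origin
  contains part of the hole.\<close>

lemma shrinking_gains_in_annulus:
  fixes s :: real
  assumes s: "1/2 < s" "s < 1"
  defines "\<rho> \<equiv> min (s - 1/2) (1 - s)"
  shows "overlap (s *\<^sub>R e1) s * \<rho>\<^sup>2 < overlap (s *\<^sub>R e1) \<rho> * s\<^sup>2"
proof -
  define x where "x = s *\<^sub>R e1"
  have nx: "norm x = s" using s by (simp add: x_def norm_axis_1)
  have \<rho>: "0 < \<rho>" using s by (simp add: \<rho>_def)
  have "y \<in> annulus (1/2)" if "y \<in> ball x \<rho>" for y
  proof -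
    have "norm x - norm y < \<rho>" "norm y - norm x < \<rho>"
      using that norm_triangle_ineq2[of x y] norm_triangle_ineq2[of y x]
      by (auto simp: dist_norm norm_minus_commute)
    then show ?thesis by (auto simp: annulus_def nx \<rho>_def)
  qed
  then have "ball x \<rho> \<inter> annulus (1/2) = ball x \<rho>" by auto
  then have 1: "overlap x \<rho> = pi * \<rho>\<^sup>2"
    using \<rho> by (simp add: overlap_def measure_disc)
  have "overlap x s < measure lebesgue (ball x s)"
    unfolding overlap_def
  proof (rule measure_less_of_open)
    show "open (ball x s \<inter> ball 0 (1/2))" by auto
    have "(1/4) *\<^sub>R e1 \<in> ball x s \<inter> ball 0 (1/2)"
      using s by (simp add: x_def dist_norm norm_axis_1 flip: scaleR_diff_left)
    then show "ball x s \<inter> ball 0 (1/2) \<noteq> {}" by blast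
    show "ball x s \<inter> annulus (1/2) \<in> lmeasurable"
      by (rule lmeasurable_ball_annulus)
  qed (auto simp: annulus_def)
  then have "overlap x s < pi * s\<^sup>2"
    using s by (simp add: measure_disc)
  then have "overlap x s * \<rho>\<^sup>2 < pi * s\<^sup>2 * \<rho>\<^sup>2"
    using \<rho> by (intro mult_strict_right_mono) auto
  then show ?thesis using 1 by (simp add: x_def mult_ac)
qed

text \<open>Passing from the disc through the origin to the disc that just covers the annulus more than doubles the
  area met: \<open>overlap_self_le\<close> leaves less than half of the annulus in the former. For centres this
  far out this outweighs the growth of the disc itself.\<close>

lemma covering_gains_outside:
  fixes s :: real
  assumes s: "49/25 \<le> s" "s \<le> 3"
  shows "overlap (s *\<^sub>R e1) s * (s + 1)\<^sup>2 < overlap (s *\<^sub>R e1) (s + 1) * s\<^sup>2"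
proof -
  have eq: "overlap (s *\<^sub>R e1) (s + 1) = 3 * pi / 4"
    using s by (intro overlap_cover) (simp add: norm_axis_1)
  have le: "overlap (s *\<^sub>R e1) s * (s + 1)\<^sup>2 \<le> (3 * pi / 8 - 7 / (24 * s)) * (s + 1)\<^sup>2"
    using s by (intro mult_right_mono overlap_self_le) auto
  have less: "(3 * pi / 8 - 7 / (24 * s)) * (s + 1)\<^sup>2 < 3 * pi / 4 * s\<^sup>2"
  proof -
    have "pi * (9 * s * (1 + 2 * s - s\<^sup>2)) < 7 * (s + 1)\<^sup>2"
    proof (cases "0 \<le> 1 + 2 * s - s\<^sup>2")
      case True
      \<comment> \<open>the cubic \<open>s * (1 + 2 * s - s\<^sup>2)\<close> is largest at the left end \<open>49/25\<close>; its difference from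
        the value there factors as shown\<close>
      have "0 \<le> (s - 49/25) * (s * (s - 1/25) - 674/625)"
      proof (intro mult_nonneg_nonneg)
        have "49/25 * (49/25 - 1/25) \<le> s * (s - 1/25)"
          using s by (intro mult_mono) auto
        then show "0 \<le> s * (s - 1/25) - 674/625" by simp
      qed (use s in auto)
      moreover have "(s - 49/25) * (s * (s - 1/25) - 674/625) = 2113664/1000000 - s * (1 + 2 * s - s\<^sup>2)"
        by (simp add: power2_eq_square field_simps)
      ultimately have "s * (1 + 2 * s - s\<^sup>2) \<le> 1057/500"
        by linarith
      moreover have "pi * (9 * (s * (1 + 2 * s - s\<^sup>2))) \<le> 63/20 * (9 * (s * (1 + 2 * s - s\<^sup>2)))"
        using pi_approx s True by (intro mult_right_mono mult_nonneg_nonneg) auto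
      moreover have "(74/25)\<^sup>2 \<le> (s + 1)\<^sup>2"
        using s by (intro power_mono) auto
      moreover have "pi * (9 * s * (1 + 2 * s - s\<^sup>2)) = pi * (9 * (s * (1 + 2 * s - s\<^sup>2)))"
        by (simp add: mult.assoc)
      moreover have "(74/25 :: real)\<^sup>2 = 5476/625" by (simp add: power2_eq_square)
      ultimately show ?thesis by linarith
    next
      case False
      then have "pi * (9 * s * (1 + 2 * s - s\<^sup>2)) \<le> 0"
        using s by (intro mult_nonneg_nonpos) auto
      also have "0 < 7 * (s + 1)\<^sup>2" using s by simp
      finally show ?thesis .
    qed
    then have "(9 * pi * s - 7) * (s + 1)\<^sup>2 / (24 * s) < 18 * pi * s ^ 3 / (24 * s)"
      using s by (intro divide_strict_right_mono) (auto simp: power2_eq_square power3_eq_cube algebra_simps)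
    then show ?thesis
      using s by (simp add: field_simps power2_eq_square power3_eq_cube)
  qed
  show ?thesis
    unfolding eq using le less by (rule le_less_trans)
qed

text \<open>The radius whose circle passes through the origin never gives the largest average of the indicator
  of the annulus. Which competitor wins depends on where the centre lies.\<close>

lemma through_origin_not_optimal:
  fixes s :: real
  assumes s: "0 < s" "s \<le> 3"
  obtains \<rho> where "0 < \<rho>" "\<rho> \<noteq> s" "overlap (s *\<^sub>R e1) s * \<rho>\<^sup>2 < overlap (s *\<^sub>R e1) \<rho> * s\<^sup>2"
proof -
  consider "s < 1/2" | "s = 1/2" | "1/2 < s" "s < 1" | "1 \<le> s" "s \<le> 49/25" | "49/25 \<le> s"
    by linarith
  then show thesis
  proof cases
    case 1
    then show thesis using growing_gains_inside[of s] s by (intro that[of "1 - s"]) auto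
  next
    case 2
    obtain \<rho> :: real where "1/2 < \<rho>"
      "overlap ((1/2) *\<^sub>R e1) (1/2) * \<rho>\<^sup>2 < overlap ((1/2) *\<^sub>R e1) \<rho> * (1/2)\<^sup>2"
      by (rule growing_gains_half)
    with 2 show thesis by (intro that[of \<rho>]) (simp_all add: \<open>s = 1/2\<close>)
  next
    case 3
    then show thesis
      using shrinking_gains_in_annulus[of s] by (intro that[of "min (s - 1/2) (1 - s)"]) auto
  next
    case 4
    then show thesis
      using shrinking_gains_near_outside[of s] by (intro that[of "sqrt (s\<^sup>2 - 1/1000)"]) auto
  next
    case 5
    then show thesis
      using covering_gains_outside[of s] s by (intro that[of "s + 1"]) auto
  qed
qed

section \<open>Discs passing near the origin\<close>

lemma overlap_le_overlap_add:
  assumes "0 \<le> t" "0 \<le> d" "dist x y + r - t \<le> d"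
  shows "overlap x r \<le> overlap y t + pi * ((t + d)\<^sup>2 - t\<^sup>2)"
proof -
  have m: "ball y (t + d) - ball y t \<in> lmeasurable" by (intro fmeasurable.Diff) auto
  have "ball x r \<inter> annulus (1/2) \<subseteq> (ball y t \<inter> annulus (1/2)) \<union> (ball y (t + d) - ball y t)"
  proof
    fix z assume z: "z \<in> ball x r \<inter> annulus (1/2)"
    then have "dist y z < t + d"
      using assms dist_triangle[of y z x] by (auto simp: dist_commute)
    then show "z \<in> (ball y t \<inter> annulus (1/2)) \<union> (ball y (t + d) - ball y t)"
      using z by auto
  qed
  then have "overlap x r \<le> measure lebesgue ((ball y t \<inter> annulus (1/2)) \<union> (ball y (t + d) - ball y t))"
    unfolding overlap_def
    by (intro measure_mono_fmeasurable fmeasurable.Un lmeasurable_ball_annulus m)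
      (auto intro: fmeasurableD lmeasurable_ball_annulus)
  also have "\<dots> \<le> overlap y t + measure lebesgue (ball y (t + d) - ball y t)"
    unfolding overlap_def by (intro measure_Un_le fmeasurableD lmeasurable_ball_annulus m)
  also have "measure lebesgue (ball y (t + d) - ball y t)
      = measure lebesgue (ball y (t + d)) - measure lebesgue (ball y t)"
    using assms by (intro measurable_measure_Diff) auto
  also have "\<dots> = pi * ((t + d)\<^sup>2 - t\<^sup>2)"
    using assms by (simp add: measure_disc algebra_simps)
  finally show ?thesis .
qed

lemma tendsto_overlap:
  fixes s r :: "nat \<Rightarrow> real"
  assumes s: "s \<longlonglongrightarrow> l" and r: "r \<longlonglongrightarrow> t" and "\<And>n. 0 \<le> r n" "0 \<le> t"
  shows "(\<lambda>n. overlap (s n *\<^sub>R e1) (r n)) \<longlonglongrightarrow> overlap (l *\<^sub>R e1) t"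
proof -
  define d where "d n = \<bar>s n - l\<bar> + \<bar>r n - t\<bar>" for n
  have d: "d \<longlonglongrightarrow> 0"
    unfolding d_def using tendsto_add[OF tendsto_rabs_zero tendsto_rabs_zero, of "\<lambda>n. s n - l" sequentially "\<lambda>n. r n - t"]
      LIM_zero[OF s] LIM_zero[OF r] by simp
  have dist: "dist (s n *\<^sub>R e1) (l *\<^sub>R e1) = \<bar>s n - l\<bar>" for n
    by (simp add: dist_norm flip: scaleR_diff_left)
  define b where "b n = pi * ((t + d n)\<^sup>2 - t\<^sup>2) + pi * ((r n + d n)\<^sup>2 - (r n)\<^sup>2)" for n
  have nn: "0 \<le> pi * ((u + d n)\<^sup>2 - u\<^sup>2)" if "0 \<le> u" for u n
    using that by (intro mult_nonneg_nonneg) (auto simp: d_def intro!: power_mono)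
  have bound: "norm (overlap (s n *\<^sub>R e1) (r n) - overlap (l *\<^sub>R e1) t) \<le> b n" for n
  proof -
    have "overlap (s n *\<^sub>R e1) (r n) \<le> overlap (l *\<^sub>R e1) t + pi * ((t + d n)\<^sup>2 - t\<^sup>2)"
      using assms by (intro overlap_le_overlap_add) (auto simp: dist d_def)
    moreover have "overlap (l *\<^sub>R e1) t \<le> overlap (s n *\<^sub>R e1) (r n) + pi * ((r n + d n)\<^sup>2 - (r n)\<^sup>2)"
      using assms by (intro overlap_le_overlap_add) (auto simp: dist dist_commute[of "l *\<^sub>R e1"] d_def)
    ultimately show ?thesis
      using nn[of t n] nn[of "r n" n] assms by (auto simp: b_def abs_le_iff)
  qed
  have "b \<longlonglongrightarrow> pi * ((t + 0)\<^sup>2 - t\<^sup>2) + pi * ((t + 0)\<^sup>2 - t\<^sup>2)"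
    unfolding b_def by (intro tendsto_intros r d)
  then have "b \<longlonglongrightarrow> 0" by simp
  then have "(\<lambda>n. overlap (s n *\<^sub>R e1) (r n) - overlap (l *\<^sub>R e1) t) \<longlonglongrightarrow> 0"
    by (rule Lim_null_comparison[OF always_eventually[OF allI[OF bound]]])
  then show ?thesis
    by (rule LIM_zero_cancel)
qed

text \<open>Compactness turns the pointwise statement \<open>through_origin_not_optimal\<close> into a uniform one: otherwise there
  are centres and radii \<open>s n\<close>, \<open>r n\<close> with ever smaller margins, which accumulate at some centre \<open>l\<close> and
  radius \<open>l\<close>, and by continuity of \<open>overlap\<close> no radius would then beat \<open>l\<close> at that centre.
  The margin \<open>pi * \<eta>\<close> leaves room for the mass of a bump of height at most \<open>\<eta>\<close>.\<close>

lemma uniform_gain_middle: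
  obtains \<eta> :: real where "0 < \<eta>" "\<eta> \<le> 1/100"
    "\<And>s r. 1/8 \<le> s \<Longrightarrow> s \<le> 3 \<Longrightarrow> 0 < r \<Longrightarrow> \<bar>s - r\<bar> < \<eta> \<Longrightarrow>
      \<exists>\<rho>>0. \<eta> \<le> \<bar>s - \<rho>\<bar> \<and> (overlap (s *\<^sub>R e1) r + pi * \<eta>) * \<rho>\<^sup>2 \<le> overlap (s *\<^sub>R e1) \<rho> * r\<^sup>2"
proof (rule ccontr)
  assume no: "\<not> thesis"
  define h where "h n = inverse (real (n + 100))" for n
  have h: "0 < h n" "h n \<le> 1/100" for n by (auto simp: h_def field_simps)
  have h0: "h \<longlonglongrightarrow> 0"
    unfolding h_def using LIMSEQ_ignore_initial_segment[OF lim_inverse_n] .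
  have "\<exists>s r. 1/8 \<le> s \<and> s \<le> 3 \<and> 0 < r \<and> \<bar>s - r\<bar> < h n \<and>
      (\<forall>\<rho>>0. h n \<le> \<bar>s - \<rho>\<bar> \<longrightarrow>
        overlap (s *\<^sub>R e1) \<rho> * r\<^sup>2 \<le> (overlap (s *\<^sub>R e1) r + pi * h n) * \<rho>\<^sup>2)" for n
  proof (rule ccontr)
    assume "\<not> ?thesis"
    then have "\<And>s r. 1/8 \<le> s \<Longrightarrow> s \<le> 3 \<Longrightarrow> 0 < r \<Longrightarrow> \<bar>s - r\<bar> < h n \<Longrightarrow>
      \<exists>\<rho>>0. h n \<le> \<bar>s - \<rho>\<bar> \<and> (overlap (s *\<^sub>R e1) r + pi * h n) * \<rho>\<^sup>2 \<le> overlap (s *\<^sub>R e1) \<rho> * r\<^sup>2"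
      by (meson linear)
    with that[of "h n"] h[of n] no show False by blast
  qed
  then obtain s r where sr: "\<And>n. 1/8 \<le> s n" "\<And>n. s n \<le> 3" "\<And>n. 0 < r n" "\<And>n. \<bar>s n - r n\<bar> < h n"
    and opt: "\<And>n \<rho>. 0 < \<rho> \<Longrightarrow> h n \<le> \<bar>s n - \<rho>\<bar> \<Longrightarrow>
        overlap (s n *\<^sub>R e1) \<rho> * (r n)\<^sup>2 \<le> (overlap (s n *\<^sub>R e1) (r n) + pi * h n) * \<rho>\<^sup>2"
    by metis
  have "compact {1/8..3::real}" by simp
  moreover have "\<forall>n. s n \<in> {1/8..3}" using sr by auto
  ultimately obtain l k where l: "l \<in> {1/8..3}" and k: "strict_mono (k :: nat \<Rightarrow> nat)" "(s \<circ> k) \<longlonglongrightarrow> l"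
    unfolding compact_def by metis
  have hk: "(h \<circ> k) \<longlonglongrightarrow> 0"
    using LIMSEQ_subseq_LIMSEQ[OF h0 k(1)] .
  have "(\<lambda>n. (r \<circ> k) n - (s \<circ> k) n) \<longlonglongrightarrow> 0"
    by (rule Lim_null_comparison[OF always_eventually hk]) (use sr(4) in \<open>auto simp: abs_minus_commute less_imp_le\<close>)
  from tendsto_add[OF this k(2)] have rk: "(r \<circ> k) \<longlonglongrightarrow> l" by (simp add: o_def)
  obtain \<rho> where \<rho>: "0 < \<rho>" "\<rho> \<noteq> l" "overlap (l *\<^sub>R e1) l * \<rho>\<^sup>2 < overlap (l *\<^sub>R e1) \<rho> * l\<^sup>2"
    using through_origin_not_optimal[of l] l by auto
  have "(\<lambda>n. \<bar>(s \<circ> k) n - \<rho>\<bar> - (h \<circ> k) n) \<longlonglongrightarrow> \<bar>l - \<rho>\<bar> - 0"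
    by (intro tendsto_intros k(2) hk)
  then have ev: "eventually (\<lambda>n. 0 < \<bar>(s \<circ> k) n - \<rho>\<bar> - (h \<circ> k) n) sequentially"
    by (rule order_tendstoD(1)) (use \<rho> in auto)
  have lim1: "(\<lambda>n. overlap ((s \<circ> k) n *\<^sub>R e1) \<rho> * ((r \<circ> k) n)\<^sup>2) \<longlonglongrightarrow> overlap (l *\<^sub>R e1) \<rho> * l\<^sup>2"
    by (intro tendsto_intros tendsto_overlap k(2) rk) (use \<rho> in auto)
  have lim2: "(\<lambda>n. (overlap ((s \<circ> k) n *\<^sub>R e1) ((r \<circ> k) n) + pi * (h \<circ> k) n) * \<rho>\<^sup>2)
      \<longlonglongrightarrow> (overlap (l *\<^sub>R e1) l + pi * 0) * \<rho>\<^sup>2"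
    by (intro tendsto_intros tendsto_overlap k(2) rk hk) (use sr l in \<open>auto simp: less_imp_le\<close>)
  have "eventually (\<lambda>n. overlap ((s \<circ> k) n *\<^sub>R e1) \<rho> * ((r \<circ> k) n)\<^sup>2 \<le>
        (overlap ((s \<circ> k) n *\<^sub>R e1) ((r \<circ> k) n) + pi * (h \<circ> k) n) * \<rho>\<^sup>2) sequentially"
    using ev by eventually_elim (use opt[OF \<rho>(1)] in auto)
  then have "overlap (l *\<^sub>R e1) \<rho> * l\<^sup>2 \<le> (overlap (l *\<^sub>R e1) l + pi * 0) * \<rho>\<^sup>2"
    by (rule tendsto_le[OF sequentially_bot lim2 lim1])
  with \<rho>(3) show False by simp
qed

text \<open>Seen from afar, a circle passing near the origin is nearly a straight line, so the disc contains
  little more than half of the annulus.\<close>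

lemma overlap_far_le:
  fixes s r :: real
  assumes s: "3 \<le> s" and r: "0 < r" "\<bar>s - r\<bar> < 1/100"
  shows "overlap (s *\<^sub>R e1) r \<le> 3 * pi / 8 + 1/50"
proof -
  have "r < s + 1/100" using r by linarith
  have "s\<^sup>2 - r\<^sup>2 = (s - r) * (s + r)" by (simp add: power2_eq_square algebra_simps)
  moreover have "\<bar>(s - r) * (s + r)\<bar> \<le> 1/100 * (2 * s + 1/100)"
    unfolding abs_mult using s r \<open>r < s + 1/100\<close> by (intro mult_mono) auto
  ultimately have w: "\<bar>s\<^sup>2 - r\<^sup>2\<bar> \<le> s / 40" using s by simp
  have "\<bar>\<tau>\<^sup>2 + (s\<^sup>2 - r\<^sup>2)\<bar> \<le> 2 * s * \<tau> \<and> - (1/40) * (2 * s * \<tau>) \<le> \<tau>\<^sup>2 + (s\<^sup>2 - r\<^sup>2)"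
    if \<tau>: "\<tau> \<in> {1/2..1}" for \<tau>
  proof -
    have "s * (1/2) \<le> s * \<tau>" "\<tau>\<^sup>2 \<le> 1" "0 \<le> \<tau>\<^sup>2"
      using \<tau> s power_mono[of \<tau> 1 2] by auto
    then show ?thesis
      using abs_le_D1[OF w] abs_le_D2[OF w] s unfolding abs_le_iff by (intro conjI; linarith)
  qed
  then have bnd: "\<And>\<tau>. \<tau> \<in> {1/2..1} \<Longrightarrow> \<bar>\<tau>\<^sup>2 + (s\<^sup>2 - r\<^sup>2)\<bar> \<le> 2 * s * \<tau>"
    and low: "\<And>\<tau>. \<tau> \<in> {1/2..1} \<Longrightarrow> - (1/40) * (2 * s * \<tau>) \<le> \<tau>\<^sup>2 + (s\<^sup>2 - r\<^sup>2)"
    by auto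
  have eq: "overlap (s *\<^sub>R e1) r = integral {1/2..1} (\<lambda>\<tau>. 2 * \<tau> * arccos ((\<tau>\<^sup>2 + (s\<^sup>2 - r\<^sup>2)) / (2 * s * \<tau>)))"
    using s r bnd by (intro overlap_eq_integral) auto
  define c where "c \<tau> = (\<tau>\<^sup>2 + (s\<^sup>2 - r\<^sup>2)) / (2 * s * \<tau>)" for \<tau>
  have c: "- (1/40) \<le> c \<tau>" "c \<tau> \<le> 1" if "\<tau> \<in> {1/2..1}" for \<tau>
  proof -
    have pos: "0 < 2 * s * \<tau>" using that s by auto
    show "- (1/40) \<le> c \<tau>" unfolding c_def pos_le_divide_eq[OF pos] by (rule low[OF that])
    show "c \<tau> \<le> 1" unfolding c_def pos_divide_le_eq[OF pos] using bnd[OF that] by simp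
  qed
  have "integral {1/2..1} (\<lambda>\<tau>. 2 * \<tau> * arccos (c \<tau>)) \<le> (pi / 2 + 1/39) * 1\<^sup>2 - (pi / 2 + 1/39) * (1/2)\<^sup>2"
  proof (rule has_integral_le[OF integrable_integral has_integral_FTC_real])
    have "\<forall>\<tau>\<in>{1/2..1}. - 1 \<le> c \<tau> \<and> c \<tau> \<le> 1" using c by force
    then show "(\<lambda>\<tau>. 2 * \<tau> * arccos (c \<tau>)) integrable_on {1/2..1}"
      using s unfolding c_def by (intro integrable_continuous_interval continuous_intros) auto
    show "((\<lambda>\<tau>. (pi / 2 + 1/39) * \<tau>\<^sup>2) has_real_derivative 2 * \<tau> * (pi / 2 + 1/39)) (at \<tau>)" for \<tau> :: real
      by (auto intro!: derivative_eq_intros)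
    fix \<tau> :: real assume \<tau>: "\<tau> \<in> {1/2..1}"
    have "arccos (c \<tau>) \<le> arccos (- (1/40))"
      using c[OF \<tau>] by (intro arccos_le_arccos) auto
    also have "\<dots> = pi / 2 + arcsin (1/40)"
      by (simp add: arccos_arcsin_eq arcsin_minus)
    also have "arcsin (1/40 :: real) \<le> 1/39"
      using arcsin_diff_le[of 0 "1/40"] by (simp add: power3_eq_cube)
    finally show "2 * \<tau> * arccos (c \<tau>) \<le> 2 * \<tau> * (pi / 2 + 1/39)"
      using \<tau> by (intro mult_left_mono) auto
  qed auto
  also have "\<dots> = 3 * pi / 8 + 1/52" by (simp add: power2_eq_square field_simps)
  finally show ?thesis
    unfolding eq c_def[symmetric] by linarith
qed

text \<open>The radii within \<open>\<eta>\<close> of the norm of the centre are exactly those whose circle can cut the disc of radius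
  \<open>\<eta>\<close> about the origin, where the bump sits. Even with the extra mass \<open>m\<close> of the bump, none of
  them does better than some radius away from that range does with the annulus alone. Centres near the
  origin see only the hole at such radii; for centres far away, the disc covering the annulus wins by a
  margin; compactness handles the range between.\<close>

lemma critical_radius_beaten:
  obtains \<eta> :: real where "0 < \<eta>" "\<eta> \<le> 1/100"
    "\<And>x r m. 0 < r \<Longrightarrow> \<bar>norm x - r\<bar> < \<eta> \<Longrightarrow> m \<le> pi * \<eta> \<Longrightarrow> m \<le> pi * \<eta> * r\<^sup>2 \<Longrightarrow>
      \<exists>\<rho>>0. \<eta> \<le> \<bar>norm x - \<rho>\<bar> \<and> (overlap x r + m) * \<rho>\<^sup>2 \<le> overlap x \<rho> * r\<^sup>2"
proof -
  obtain \<eta> :: real where \<eta>: "0 < \<eta>" "\<eta> \<le> 1/100" and mid: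
    "\<And>s r. 1/8 \<le> s \<Longrightarrow> s \<le> 3 \<Longrightarrow> 0 < r \<Longrightarrow> \<bar>s - r\<bar> < \<eta> \<Longrightarrow>
      \<exists>\<rho>>0. \<eta> \<le> \<bar>s - \<rho>\<bar> \<and> (overlap (s *\<^sub>R e1) r + pi * \<eta>) * \<rho>\<^sup>2 \<le> overlap (s *\<^sub>R e1) \<rho> * r\<^sup>2"
    using uniform_gain_middle by blast
  have "\<exists>\<rho>>0. \<eta> \<le> \<bar>norm x - \<rho>\<bar> \<and> (overlap x r + m) * \<rho>\<^sup>2 \<le> overlap x \<rho> * r\<^sup>2"
    if r: "0 < r" "\<bar>norm x - r\<bar> < \<eta>" and m: "m \<le> pi * \<eta>" "m \<le> pi * \<eta> * r\<^sup>2" for x r m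
  proof -
    define s where "s = norm x"
    have s0: "0 \<le> s" by (simp add: s_def)
    have full: "overlap x (s + 1) = 3 * pi / 4" by (rule overlap_cover) (simp add: s_def)
    consider "s \<le> 1/8" | "1/8 \<le> s" "s \<le> 3" | "3 \<le> s" by linarith
    then show ?thesis
    proof cases
      case 1
      have "overlap x r = 0"
        using 1 r \<eta> by (intro overlap_hole) (auto simp: s_def)
      moreover have "m * (s + 1)\<^sup>2 \<le> 3 * pi / 4 * r\<^sup>2"
      proof -
        have "m * (s + 1)\<^sup>2 \<le> pi * \<eta> * r\<^sup>2 * (s + 1)\<^sup>2"
          using m by (intro mult_right_mono) auto
        also have "\<dots> \<le> pi * (1/100) * r\<^sup>2 * 2\<^sup>2"
          using 1 s0 \<eta> r by (intro mult_mono power_mono) auto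
        also have "\<dots> \<le> 3 * pi / 4 * r\<^sup>2" by simp
        finally show ?thesis .
      qed
      ultimately show ?thesis
        using s0 \<eta> by (intro exI[of _ "s + 1"]) (simp add: full s_def[symmetric])
    next
      case 2
      obtain \<rho> where \<rho>: "0 < \<rho>" "\<eta> \<le> \<bar>s - \<rho>\<bar>"
        "(overlap (s *\<^sub>R e1) r + pi * \<eta>) * \<rho>\<^sup>2 \<le> overlap (s *\<^sub>R e1) \<rho> * r\<^sup>2"
        using mid[of s r] 2 r by (auto simp: s_def)
      have "(overlap (s *\<^sub>R e1) r + m) * \<rho>\<^sup>2 \<le> (overlap (s *\<^sub>R e1) r + pi * \<eta>) * \<rho>\<^sup>2"
        using m by (intro mult_right_mono) auto
      then have "(overlap x r + m) * \<rho>\<^sup>2 \<le> overlap x \<rho> * r\<^sup>2"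
        using \<rho>(3) by (simp only: overlap_e1[of x] s_def)
      then show ?thesis
        using \<rho> by (auto simp: s_def)
    next
      case 3
      have "overlap x r \<le> 3 * pi / 8 + 1/50"
        using overlap_far_le[of s r] 3 r \<eta> by (simp add: overlap_e1[of x] s_def)
      moreover have "pi * \<eta> \<le> pi * (1/100)"
        using \<eta> by (intro mult_left_mono) auto
      moreover have "pi \<le> 63/20" using pi_approx by simp
      ultimately have "overlap x r + m \<le> 5/4"
        using m(1) by linarith
      then have "(overlap x r + m) * (s + 1)\<^sup>2 \<le> 5/4 * (s + 1)\<^sup>2"
        by (intro mult_right_mono) auto
      also have "\<dots> \<le> 5/4 * (27/20 * r)\<^sup>2"
        using 3 r \<eta> by (intro mult_left_mono power_mono) (auto simp: s_def)
      also have "\<dots> = 5/4 * (27/20)\<^sup>2 * r\<^sup>2" by (simp only: power_mult_distrib mult.assoc)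
      also have "\<dots> \<le> 3 * pi / 4 * r\<^sup>2"
        using pi_approx by (intro mult_right_mono) (auto simp: power2_eq_square)
      finally show ?thesis
        using s0 \<eta> by (intro exI[of _ "s + 1"]) (simp add: full s_def[symmetric])
    qed
  qed
  with \<eta> that show thesis by blast
qed

section \<open>The maximal function of the annulus with a bump\<close>

lemma nn_integral_annulus_bump:
  assumes "0 \<le> \<epsilon>"
  shows "(\<integral>\<^sup>+t\<in>ball x r. ennreal \<bar>annulus_bump (1/2) \<epsilon> \<sigma> a t\<bar> \<partial>lebesgue)
    = ennreal (overlap x r + \<epsilon> * measure lebesgue (ball x r \<inter> ball a \<sigma>))"
proof -
  have m: "ball x r \<inter> annulus (1/2) \<in> lmeasurable" "ball x r \<inter> ball a \<sigma> \<in> lmeasurable"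
    by (auto intro: lmeasurable_ball_annulus)
  then have [measurable]: "ball x r \<inter> annulus (1/2) \<in> sets lebesgue" "ball x r \<inter> ball a \<sigma> \<in> sets lebesgue"
    by auto
  have "(\<integral>\<^sup>+t\<in>ball x r. ennreal \<bar>annulus_bump (1/2) \<epsilon> \<sigma> a t\<bar> \<partial>lebesgue)
    = (\<integral>\<^sup>+t. indicator (ball x r \<inter> annulus (1/2)) t + ennreal \<epsilon> * indicator (ball x r \<inter> ball a \<sigma>) t \<partial>lebesgue)"
    using assms by (intro nn_integral_cong) (auto simp: annulus_bump_def indicator_def)
  also have "\<dots> = emeasure lebesgue (ball x r \<inter> annulus (1/2)) + ennreal \<epsilon> * emeasure lebesgue (ball x r \<inter> ball a \<sigma>)"
    by (subst nn_integral_add) (simp_all add: nn_integral_cmult_indicator)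
  also have "\<dots> = ennreal (overlap x r + \<epsilon> * measure lebesgue (ball x r \<inter> ball a \<sigma>))"
    using assms m
    by (simp add: overlap_def emeasure_eq_measure2 ennreal_plus ennreal_mult del: emeasure_completion measure_completion)
  finally show ?thesis .
qed

definition bump_average :: "real \<Rightarrow> real \<Rightarrow> real^2 \<Rightarrow> real^2 \<Rightarrow> real \<Rightarrow> real" where
  "bump_average \<epsilon> \<sigma> a x r =
     (overlap x r + \<epsilon> * measure lebesgue (ball x r \<inter> ball a \<sigma>)) / (pi * r\<^sup>2)"

lemma central_maximal_annulus_bump:
  assumes "0 \<le> \<epsilon>"
  shows "central_maximal (annulus_bump (1/2) \<epsilon> \<sigma> a) x = (SUP r\<in>{0<..}. ennreal (bump_average \<epsilon> \<sigma> a x r))"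
  unfolding central_maximal_def
proof (rule SUP_cong)
  fix r :: real assume "r \<in> {0<..}"
  then have r: "0 < r" by simp
  have "emeasure lebesgue (ball x r) = ennreal (pi * r\<^sup>2)"
    using r emeasure_ball[of r x] by (simp add: unit_ball_vol_2)
  then show "(\<integral>\<^sup>+t\<in>ball x r. ennreal \<bar>annulus_bump (1/2) \<epsilon> \<sigma> a t\<bar> \<partial>lebesgue) / emeasure lebesgue (ball x r)
      = ennreal (bump_average \<epsilon> \<sigma> a x r)"
    using r assms overlap_nonneg[of x r]
    by (simp only: nn_integral_annulus_bump[OF assms] bump_average_def) (subst divide_ennreal, auto)
qed simp

text \<open>If the circle keeps distance \<open>\<eta>\<close> from the origin, the disc either misses the bump or swallows
  it, wherever the bump lies within distance \<open>\<eta>\<close> of the origin.\<close>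

lemma measure_ball_Int_bump_far:
  fixes a a' x :: "'a::euclidean_space"
  assumes "norm a + \<sigma> < \<eta>" "norm a' + \<sigma> < \<eta>" "0 \<le> \<sigma>" and "\<eta> \<le> \<bar>norm x - r\<bar>"
  shows "measure lebesgue (ball x r \<inter> ball a \<sigma>) = measure lebesgue (ball x r \<inter> ball a' \<sigma>)"
proof -
  have small: "norm y < \<eta>" if "y \<in> ball b \<sigma>" "norm b + \<sigma> < \<eta>" for y b :: 'a
    using that norm_triangle_ineq2[of y b] by (simp add: dist_norm norm_minus_commute)
  show ?thesis
  proof (cases "norm x \<ge> r + \<eta>")
    case True
    have "ball x r \<inter> ball b \<sigma> = {}" if "norm b + \<sigma> < \<eta>" for b :: 'a
    proof -
      have False if "y \<in> ball x r" "y \<in> ball b \<sigma>" for y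
        using that True small[OF that(2) \<open>norm b + \<sigma> < \<eta>\<close>] norm_triangle_ineq2[of x y]
        by (simp add: dist_norm)
      then show ?thesis by blast
    qed
    then show ?thesis using assms by simp
  next
    case False
    then have r: "norm x + \<eta> \<le> r" using assms by linarith
    have "ball x r \<inter> ball b \<sigma> = ball b \<sigma>" if "norm b + \<sigma> < \<eta>" for b :: 'a
    proof -
      have "y \<in> ball x r" if "y \<in> ball b \<sigma>" for y
        using that r small[OF that \<open>norm b + \<sigma> < \<eta>\<close>] norm_triangle_ineq4[of x y]
        by (simp add: dist_norm)
      then show ?thesis by blast
    qed
    then show ?thesis using assms by (simp add: content_ball)
  qed
qed

lemma measure_ball_Int_bump_le:
  fixes a x :: "real^2"
  assumes "0 \<le> \<sigma>" "\<sigma> \<le> 1" "0 \<le> r"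
  shows "measure lebesgue (ball x r \<inter> ball a \<sigma>) \<le> pi"
    and "measure lebesgue (ball x r \<inter> ball a \<sigma>) \<le> pi * r\<^sup>2"
proof -
  have "measure lebesgue (ball x r \<inter> ball a \<sigma>) \<le> measure lebesgue (ball a \<sigma>)"
    by (intro measure_mono_fmeasurable) auto
  also have "\<dots> = pi * \<sigma>\<^sup>2" using assms by (simp add: measure_disc)
  also have "\<dots> \<le> pi * 1" using assms by (intro mult_left_mono) (auto simp: power_le_one)
  finally show "measure lebesgue (ball x r \<inter> ball a \<sigma>) \<le> pi" by simp
  have "measure lebesgue (ball x r \<inter> ball a \<sigma>) \<le> measure lebesgue (ball x r)"
    by (intro measure_mono_fmeasurable) auto
  also have "\<dots> = pi * r\<^sup>2" using assms by (simp add: measure_disc)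
  finally show "measure lebesgue (ball x r \<inter> ball a \<sigma>) \<le> pi * r\<^sup>2" .
qed

text \<open>Every average for the bump at \<open>a\<close> is dominated by one for the bump at \<open>a'\<close>: at the same radius if
  the circle stays away from the bump, and otherwise at the radius that beats it.\<close>

lemma bump_average_le_bump_average:
  assumes \<epsilon>: "0 \<le> \<epsilon>" "\<epsilon> \<le> \<eta>" and \<sigma>: "0 \<le> \<sigma>" "\<sigma> \<le> 1"
    and a: "norm a + \<sigma> < \<eta>" "norm a' + \<sigma> < \<eta>" and "0 < r"
    and beaten: "\<And>m. \<bar>norm x - r\<bar> < \<eta> \<Longrightarrow> m \<le> pi * \<eta> \<Longrightarrow> m \<le> pi * \<eta> * r\<^sup>2 \<Longrightarrow>
      \<exists>\<rho>>0. \<eta> \<le> \<bar>norm x - \<rho>\<bar> \<and> (overlap x r + m) * \<rho>\<^sup>2 \<le> overlap x \<rho> * r\<^sup>2"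
  shows "\<exists>\<rho>>0. bump_average \<epsilon> \<sigma> a x r \<le> bump_average \<epsilon> \<sigma> a' x \<rho>"
proof (cases "\<eta> \<le> \<bar>norm x - r\<bar>")
  case True
  then show ?thesis
    using \<open>0 < r\<close> measure_ball_Int_bump_far[OF a \<sigma>(1)]
    by (intro exI[of _ r]) (simp add: bump_average_def)
next
  case False
  define m where "m = \<epsilon> * measure lebesgue (ball x r \<inter> ball a \<sigma>)"
  have "m \<le> \<eta> * pi" "m \<le> \<eta> * (pi * r\<^sup>2)"
    unfolding m_def using measure_ball_Int_bump_le[OF \<sigma>, of r x a] \<epsilon> \<open>0 < r\<close>
    by (auto intro!: mult_mono)
  then obtain \<rho> where \<rho>: "0 < \<rho>" "(overlap x r + m) * \<rho>\<^sup>2 \<le> overlap x \<rho> * r\<^sup>2"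
    using beaten[of m] False by (auto simp: mult_ac)
  have "bump_average \<epsilon> \<sigma> a x r = (overlap x r + m) / (pi * r\<^sup>2)"
    by (simp add: bump_average_def m_def)
  also have "\<dots> \<le> overlap x \<rho> / (pi * \<rho>\<^sup>2)"
  proof -
    have "(overlap x r + m) / r\<^sup>2 \<le> overlap x \<rho> / \<rho>\<^sup>2"
      using \<rho> \<open>0 < r\<close> by (simp add: divide_le_eq pos_le_divide_eq)
    then have "(overlap x r + m) / r\<^sup>2 / pi \<le> overlap x \<rho> / \<rho>\<^sup>2 / pi"
      by (rule divide_right_mono) simp
    then show ?thesis by (simp add: mult.commute)
  qed
  also have "\<dots> \<le> bump_average \<epsilon> \<sigma> a' x \<rho>"
    unfolding bump_average_def using \<epsilon> by (intro divide_right_mono) auto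
  finally show ?thesis using \<rho> by blast
qed

lemma annulus_bump_nonneg: "0 \<le> \<epsilon> \<Longrightarrow> 0 \<le> annulus_bump \<delta> \<epsilon> \<sigma> a y"
  by (simp add: annulus_bump_def)

lemma bounded_range_annulus_bump: "bounded (range (annulus_bump \<delta> \<epsilon> \<sigma> a))"
proof (rule boundedI)
  fix y assume "y \<in> range (annulus_bump \<delta> \<epsilon> \<sigma> a)"
  then show "norm y \<le> 1 + \<bar>\<epsilon>\<bar>"
    by (auto simp: annulus_bump_def indicator_def)
qed

lemma compactly_supported_annulus_bump: "compactly_supported (annulus_bump \<delta> \<epsilon> \<sigma> a)"
proof -
  have "{y. annulus_bump \<delta> \<epsilon> \<sigma> a y \<noteq> 0} \<subseteq> ball 0 1 \<union> ball a \<sigma>"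
    by (auto simp: annulus_bump_def annulus_def indicator_def split: if_splits)
  then have "bounded {y. annulus_bump \<delta> \<epsilon> \<sigma> a y \<noteq> 0}"
    by (rule bounded_subset[rotated]) auto
  then show ?thesis
    by (simp add: compactly_supported_def compact_closure)
qed

lemma integrable_annulus_bump: "integrable lebesgue (annulus_bump \<delta> \<epsilon> \<sigma> a)"
proof -
  have "bounded (annulus \<delta>)"
    by (rule bounded_subset[of "ball 0 1"]) (auto simp: annulus_def)
  then have "annulus \<delta> \<in> lmeasurable"
    by (intro lmeasurable_open open_annulus)
  then have "integrable lebesgue (indicator (annulus \<delta>) :: _ \<Rightarrow> real)"
    by (intro integrable_real_indicator) (auto simp: fmeasurable_def)
  moreover have "integrable lebesgue (\<lambda>y. \<epsilon> * indicator (ball a \<sigma>) y)"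
    using lmeasurable_ball[of a \<sigma>]
    by (intro integrable_mult_right integrable_real_indicator) (auto simp: fmeasurable_def)
  ultimately show ?thesis
    unfolding annulus_bump_def[abs_def] by (rule Bochner_Integration.integrable_add)
qed

lemma L1_norm_annulus_bump_diff:
  assumes "0 \<le> \<epsilon>" "0 \<le> \<sigma>" and disj: "ball a \<sigma> \<inter> ball b \<sigma> = {}"
  shows "L1_norm (\<lambda>y. annulus_bump \<delta> \<epsilon> \<sigma> a y - annulus_bump \<delta> \<epsilon> \<sigma> b y) = ennreal (2 * \<epsilon> * pi * \<sigma>\<^sup>2)"
proof -
  have e: "emeasure lebesgue (ball c \<sigma>) = ennreal (pi * \<sigma>\<^sup>2)" for c :: "real^2"
    using assms emeasure_ball[of \<sigma> c] by (simp add: unit_ball_vol_2)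
  have [measurable]: "ball c \<sigma> \<in> sets lebesgue" for c :: "real^2"
    by auto
  have M: "(\<lambda>y. ennreal \<epsilon> * indicator (ball c \<sigma>) y) \<in> borel_measurable lebesgue" for c :: "real^2"
    by measurable
  have "L1_norm (\<lambda>y. annulus_bump \<delta> \<epsilon> \<sigma> a y - annulus_bump \<delta> \<epsilon> \<sigma> b y)
    = (\<integral>\<^sup>+y. ennreal \<epsilon> * indicator (ball a \<sigma>) y + ennreal \<epsilon> * indicator (ball b \<sigma>) y \<partial>lebesgue)"
    unfolding L1_norm_def
  proof (rule nn_integral_cong)
    fix y
    show "ennreal \<bar>annulus_bump \<delta> \<epsilon> \<sigma> a y - annulus_bump \<delta> \<epsilon> \<sigma> b y\<bar> =
        ennreal \<epsilon> * indicator (ball a \<sigma>) y + ennreal \<epsilon> * indicator (ball b \<sigma>) y"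
      using assms disj by (cases "y \<in> ball a \<sigma>"; cases "y \<in> ball b \<sigma>") (auto simp: annulus_bump_def)
  qed
  also have "\<dots> = ennreal \<epsilon> * ennreal (pi * \<sigma>\<^sup>2) + ennreal \<epsilon> * ennreal (pi * \<sigma>\<^sup>2)"
    by (subst nn_integral_add) (simp_all add: M nn_integral_cmult_indicator e del: emeasure_completion nn_integral_completion)
  also have "\<dots> = ennreal (2 * \<epsilon> * pi * \<sigma>\<^sup>2)"
    using assms by (simp flip: ennreal_mult ennreal_plus add: algebra_simps)
  finally show ?thesis .
qed

theorem theorem3:
  fixes \<delta> :: real
  assumes "\<delta> = 1 / 2"
  shows "\<exists>\<eta> \<epsilon>\<^sub>0 :: real. 0 < \<eta> \<and> \<eta> < \<delta> \<and> 0 < \<epsilon>\<^sub>0 \<and>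
    (\<forall>\<epsilon> \<sigma>. 0 < \<epsilon> \<and> \<epsilon> \<le> \<epsilon>\<^sub>0 \<and> 0 < \<sigma> \<and> \<sigma> < \<eta> \<longrightarrow>
      (\<forall>a a' :: real^2. norm a + \<sigma> < \<eta> \<and> norm a' + \<sigma> < \<eta> \<longrightarrow>
        (\<forall>x. central_maximal (annulus_bump \<delta> \<epsilon> \<sigma> a) x
            = central_maximal (annulus_bump \<delta> \<epsilon> \<sigma> a') x))) \<and>
    (\<forall>\<epsilon>. 0 < \<epsilon> \<and> \<epsilon> \<le> \<epsilon>\<^sub>0 \<longrightarrow>
      (\<forall>\<sigma> a b f g. \<sigma> = \<eta> / 8 \<and> a = vector [\<eta> / 4, 0] \<and> b = vector [- \<eta> / 4, 0] \<and>
          f = annulus_bump \<delta> \<epsilon> \<sigma> a \<and> g = annulus_bump \<delta> \<epsilon> \<sigma> b \<longrightarrow>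
        (\<forall>h\<in>{f, g}. bounded (range h) \<and> (\<forall>x. 0 \<le> h x) \<and> compactly_supported h \<and>
            integrable lebesgue h) \<and>
        (\<forall>x. central_maximal f x = central_maximal g x) \<and>
        L1_norm (\<lambda>x. f x - g x) = ennreal (2 * \<epsilon> * pi * \<sigma>\<^sup>2) \<and>
        0 < 2 * \<epsilon> * pi * \<sigma>\<^sup>2))"
proof -
  obtain \<eta> :: real where \<eta>: "0 < \<eta>" "\<eta> \<le> 1/100" and beaten:
    "\<And>(x :: real^2) r m. 0 < r \<Longrightarrow> \<bar>norm x - r\<bar> < \<eta> \<Longrightarrow> m \<le> pi * \<eta> \<Longrightarrow> m \<le> pi * \<eta> * r\<^sup>2 \<Longrightarrow>
      \<exists>\<rho>>0. \<eta> \<le> \<bar>norm x - \<rho>\<bar> \<and> (overlap x r + m) * \<rho>\<^sup>2 \<le> overlap x \<rho> * r\<^sup>2"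
    using critical_radius_beaten by blast
  have le: "central_maximal (annulus_bump \<delta> \<epsilon> \<sigma> a) x \<le> central_maximal (annulus_bump \<delta> \<epsilon> \<sigma> a') x"
    if "0 < \<epsilon>" "\<epsilon> \<le> \<eta>" "0 < \<sigma>" "\<sigma> < \<eta>" "norm a + \<sigma> < \<eta>" "norm a' + \<sigma> < \<eta>" for \<epsilon> \<sigma> a a' x
  proof -
    have "\<exists>\<rho>\<in>{0<..}. ennreal (bump_average \<epsilon> \<sigma> a x r) \<le> ennreal (bump_average \<epsilon> \<sigma> a' x \<rho>)"
      if "r \<in> {0<..}" for r
      using bump_average_le_bump_average[of \<epsilon> \<eta> \<sigma> a a' r x] beaten[of r x] \<eta> that
        \<open>0 < \<epsilon>\<close> \<open>\<epsilon> \<le> \<eta>\<close> \<open>0 < \<sigma>\<close> \<open>\<sigma> < \<eta>\<close> \<open>norm a + \<sigma> < \<eta>\<close> \<open>norm a' + \<sigma> < \<eta>\<close>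
      by (force intro: ennreal_leI)
    then show ?thesis
      unfolding assms central_maximal_annulus_bump[OF less_imp_le[OF \<open>0 < \<epsilon>\<close>]] by (rule SUP_mono)
  qed
  then have eq: "central_maximal (annulus_bump \<delta> \<epsilon> \<sigma> a) x = central_maximal (annulus_bump \<delta> \<epsilon> \<sigma> a') x"
    if "0 < \<epsilon>" "\<epsilon> \<le> \<eta>" "0 < \<sigma>" "\<sigma> < \<eta>" "norm a + \<sigma> < \<eta>" "norm a' + \<sigma> < \<eta>" for \<epsilon> \<sigma> a a' x
    using that by (intro antisym) blast+
  define a b :: "real^2" where "a = vector [\<eta> / 4, 0]" and "b = vector [- \<eta> / 4, 0]"
  have ab: "a = (\<eta> / 4) *\<^sub>R e1" "b = (- \<eta> / 4) *\<^sub>R e1"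
    by (simp_all add: a_def b_def vec_eq_iff forall_2 axis_def)
  have norm_ab: "norm a = \<eta> / 4" "norm b = \<eta> / 4"
    using \<eta> by (simp_all add: ab)
  have "dist a b = \<eta> / 2"
    using \<eta> unfolding ab dist_norm scaleR_diff_left[symmetric] by simp
  then have disj: "ball a (\<eta> / 8) \<inter> ball b (\<eta> / 8) = {}"
    using \<eta> by (intro disjoint_ballI) simp
  show ?thesis
  proof (rule exI[of _ \<eta>], rule exI[of _ \<eta>], intro conjI)
    show "\<eta> < \<delta>" using \<eta> assms by simp
    show "\<forall>\<epsilon> \<sigma>. 0 < \<epsilon> \<and> \<epsilon> \<le> \<eta> \<and> 0 < \<sigma> \<and> \<sigma> < \<eta> \<longrightarrow>
      (\<forall>a a' :: real^2. norm a + \<sigma> < \<eta> \<and> norm a' + \<sigma> < \<eta> \<longrightarrow>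
        (\<forall>x. central_maximal (annulus_bump \<delta> \<epsilon> \<sigma> a) x = central_maximal (annulus_bump \<delta> \<epsilon> \<sigma> a') x))"
      using eq by blast
    have "(\<forall>h\<in>{annulus_bump \<delta> \<epsilon> (\<eta> / 8) a, annulus_bump \<delta> \<epsilon> (\<eta> / 8) b}.
          bounded (range h) \<and> (\<forall>x. 0 \<le> h x) \<and> compactly_supported h \<and> integrable lebesgue h) \<and>
        (\<forall>x. central_maximal (annulus_bump \<delta> \<epsilon> (\<eta> / 8) a) x = central_maximal (annulus_bump \<delta> \<epsilon> (\<eta> / 8) b) x) \<and>
        L1_norm (\<lambda>x. annulus_bump \<delta> \<epsilon> (\<eta> / 8) a x - annulus_bump \<delta> \<epsilon> (\<eta> / 8) b x)
          = ennreal (2 * \<epsilon> * pi * (\<eta> / 8)\<^sup>2) \<and>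
        0 < 2 * \<epsilon> * pi * (\<eta> / 8)\<^sup>2" if "0 < \<epsilon>" "\<epsilon> \<le> \<eta>" for \<epsilon>
    proof (intro conjI)
      show "\<forall>h\<in>{annulus_bump \<delta> \<epsilon> (\<eta> / 8) a, annulus_bump \<delta> \<epsilon> (\<eta> / 8) b}.
          bounded (range h) \<and> (\<forall>x. 0 \<le> h x) \<and> compactly_supported h \<and> integrable lebesgue h"
        using that by (auto intro: bounded_range_annulus_bump annulus_bump_nonneg
            compactly_supported_annulus_bump integrable_annulus_bump)
      show "\<forall>x. central_maximal (annulus_bump \<delta> \<epsilon> (\<eta> / 8) a) x = central_maximal (annulus_bump \<delta> \<epsilon> (\<eta> / 8) b) x"
        using that \<eta> norm_ab by (intro allI eq) auto
      show "L1_norm (\<lambda>x. annulus_bump \<delta> \<epsilon> (\<eta> / 8) a x - annulus_bump \<delta> \<epsilon> (\<eta> / 8) b x)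
          = ennreal (2 * \<epsilon> * pi * (\<eta> / 8)\<^sup>2)"
        using that \<eta> by (intro L1_norm_annulus_bump_diff disj) auto
      show "0 < 2 * \<epsilon> * pi * (\<eta> / 8)\<^sup>2"
        using that \<eta> by simp
    qed
    then show "\<forall>\<epsilon>. 0 < \<epsilon> \<and> \<epsilon> \<le> \<eta> \<longrightarrow>
      (\<forall>\<sigma> a b f g. \<sigma> = \<eta> / 8 \<and> a = vector [\<eta> / 4, 0] \<and> b = vector [- \<eta> / 4, 0] \<and>
          f = annulus_bump \<delta> \<epsilon> \<sigma> a \<and> g = annulus_bump \<delta> \<epsilon> \<sigma> b \<longrightarrow>
        (\<forall>h\<in>{f, g}. bounded (range h) \<and> (\<forall>x. 0 \<le> h x) \<and> compactly_supported h \<and>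
            integrable lebesgue h) \<and>
        (\<forall>x. central_maximal f x = central_maximal g x) \<and>
        L1_norm (\<lambda>x. f x - g x) = ennreal (2 * \<epsilon> * pi * \<sigma>\<^sup>2) \<and>
        0 < 2 * \<epsilon> * pi * \<sigma>\<^sup>2)"
      unfolding a_def b_def by blast
  qed (use \<eta> in auto)
qed

end
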